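(* Let $0<\alpha<1$, $x>0$ and let $y\in C^\infty[0,x]$ satisfy $y(0)=y'(0)=0$. For integers $n\ge 4$ put $h=x/n$, $y_j=y(jh)$ for $0\le j\le n$, and define $$\omega_0^{(\alpha)}=1,\quad \omega_1^{(\alpha)}=\frac{1}{2^\alpha},\quad \omega_k^{(\alpha)}=\frac{1}{(k+1)^\alpha}-\frac{1}{(k-1)^\alpha}\ (2\le k\le n-2),\quad \omega_{n-1}^{(\alpha)}=-\frac{1}{(n-2)^\alpha},\quad \omega_n^{(\alpha)}=-\frac{1}{(n-1)^\alpha}.$$ Then, as $n\to\infty$ with $x$ fixed, $$\frac{1}{2\Gamma(1-\alpha)h^\alpha}\sum_{k=0}^{n}\omega_k^{(\alpha)}y_{n-k}=y^{(\alpha)}(x)+\frac{\zeta(\alpha)}{\Gamma(1-\alpha)}y'(x)h^{1-\alpha}-\frac{\zeta(\alpha-1)}{\Gamma(1-\alpha)}y''(x)h^{2-\alpha}+O\left(h^2\right).$$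
   Context: $\zeta$ is the Riemann zeta function (analytically continued). For $0<\alpha<1$ the Caputo derivative is $y^{(\alpha)}(x)=\frac{1}{\Gamma(1-\alpha)}\int_0^x\frac{y'(t)}{(x-t)^\alpha}\,dt$. The constant implied by $O(\cdot)$ may depend on $y,\alpha,x$ but not on $n$. *)

theory Defs
  imports "HOL-Complex_Analysis.Complex_Analysis"
begin

(* By the identity theorem the two conditions determine zeta on all of - {1};
   the value at the pole is unspecified. *)
definition zeta :: "complex \<Rightarrow> complex" where
  "zeta = (SOME f. f holomorphic_on - {1} \<and>
     (\<forall>s. Re s > 1 \<longrightarrow> (\<lambda>n. 1 / of_nat (Suc n) powr s) sums f s))"

(* Derivatives are relative to S, so for S = {a..b} they are one-sided at the endpoints
   and only the values of f on S matter. *)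
primrec nth_deriv_within :: "nat \<Rightarrow> real set \<Rightarrow> (real \<Rightarrow> real) \<Rightarrow> real \<Rightarrow> real" where
  "nth_deriv_within 0 S f = f"
| "nth_deriv_within (Suc k) S f =
     (\<lambda>t. vector_derivative (nth_deriv_within k S f) (at t within S))"

definition smooth_within :: "real set \<Rightarrow> (real \<Rightarrow> real) \<Rightarrow> bool" where
  "smooth_within S f \<longleftrightarrow> (\<forall>k. nth_deriv_within k S f differentiable_on S)"

(* The integrand is singular at t = x; its value there (0 in HOL) does not affect the integral. *)
definition caputo_deriv :: "real \<Rightarrow> (real \<Rightarrow> real) \<Rightarrow> real \<Rightarrow> real" where
  "caputo_deriv \<alpha> y x = 1 / Gamma (1 - \<alpha>) *
     integral {0..x} (\<lambda>t. nth_deriv_within 1 {0..x} y t / (x - t) powr \<alpha>)"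

(* The case distinction is the intended one for n \<ge> 4 and k \<le> n. *)
definition omega :: "real \<Rightarrow> nat \<Rightarrow> nat \<Rightarrow> real" where
  "omega \<alpha> n k =
     (if k = 0 then 1
      else if k = 1 then 1 / 2 powr \<alpha>
      else if k \<le> n - 2 then 1 / (real k + 1) powr \<alpha> - 1 / (real k - 1) powr \<alpha>
      else if k = n - 1 then - (1 / (real n - 2) powr \<alpha>)
      else - (1 / (real n - 1) powr \<alpha>))"

end

theory Submission
  imports Defs
begin

text \<open>
  Since \<open>y'(0) = 0\<close>, the sum is a discretisation of the Caputo integral on a uniform grid. The
  weights are differences of \<open>1 / m powr \<alpha>\<close> shifted by one in either direction, so a summation by
  parts turns the sum into \<open>m powr - \<alpha>\<close> times central differences of \<open>y\<close>
  (\<open>sum_omega_eq\<close>). Up to \<open>O(h^3)\<close> each central difference is \<open>2 h y'(x - m h)\<close>, and as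
  \<open>t powr - \<alpha>\<close> is integrable these errors add up to \<open>O(h^2)\<close>. What remains is the
  trapezoidal sum, without the node at the singularity, of \<open>t powr - \<alpha> * g t\<close> for
  \<open>g t = y'(x - t)\<close>; the endpoint term at \<open>t = x\<close> is there for free because it vanishes.

  This sum obeys a singular Euler-Maclaurin formula (\<open>singular_euler_maclaurin\<close>). The linear Taylor
  polynomial of \<open>g\<close> at \<open>0\<close> is split off. The remainder, divided by \<open>t powr \<alpha>\<close>, has a second
  derivative of order \<open>t powr - \<alpha>\<close>, which is integrable, so that the trapezoidal rule is still
  accurate to \<open>O(h^2)\<close> on it. By scaling, the two powers \<open>t powr - s\<close> with \<open>s = \<alpha>\<close> and
  \<open>s = \<alpha> - 1\<close> lead to the sums of \<open>m powr - s\<close> over \<open>m < n\<close>, whose constant term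
  in the asymptotic expansion is the value of the zeta function at \<open>s\<close>
  (\<open>zeta_trapezoid_asymp\<close>). These constants are the two correction terms of the theorem;
  the sign of the second one comes from \<open>g'(0) = - y''(x)\<close>.

  As \<open>zeta\<close> is the choice of some continuation of the Dirichlet series, nothing is known about its
  value outside the half-plane of convergence before a continuation to all of \<open>- {1}\<close> has been
  constructed. Expanding \<open>(n + 1) powr (1 - s)\<close> around \<open>n\<close> and summing over \<open>n\<close> expresses
  \<open>(s - 1) \<zeta>(s)\<close> by values of \<open>\<zeta>\<close> at \<open>s + 1, s + 2, ...\<close> and a series of Taylor
  remainders, which converges the further to the left the longer the expansion is. This moves the
  half-plane of definition to the left one unit at a time (\<open>zeta_mult_on_step\<close>).
\<close>

section \<open>Continuation of the zeta function\<close>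

text \<open>
  The remainder of the Taylor expansion of \<open>z powr a\<close> around \<open>n + 1\<close>, evaluated at \<open>n + 2\<close>. The
  shift by one makes the index range over all natural numbers while the base stays positive.
\<close>
definition powr_taylor_rem :: "nat \<Rightarrow> complex \<Rightarrow> nat \<Rightarrow> complex" where
  "powr_taylor_rem M a n = of_nat (Suc (Suc n)) powr a
     - (\<Sum>i\<le>M. (a gchoose i) * of_nat (Suc n) powr (a - of_nat i))"

lemma norm_of_nat_Suc_powr: "norm (of_nat (Suc n) powr (z :: complex)) = real (Suc n) powr Re z"
  using norm_powr_real_powr[of "of_nat (Suc n)" z] by (metis Re_complex_of_real Reals_of_nat of_nat_0_le_iff of_real_of_nat_eq)

lemma gbinomial_Suc_absorb:
  fixes a :: "'a :: field_char_0"
  shows "fact (Suc i) * (a gchoose Suc i) = fact i * (a gchoose i) * (a - of_nat i)"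
proof -
  have *: "of_nat (Suc i) * (a gchoose Suc i) = (a gchoose i) * (a - of_nat i)"
    using gbinomial_mult_1[of a i] by (simp add: algebra_simps)
  have "fact (Suc i) * (a gchoose Suc i) = fact i * (of_nat (Suc i) * (a gchoose Suc i))"
    by (simp only: fact_Suc mult_ac)
  then show ?thesis
    unfolding * by (simp add: mult_ac)
qed

text \<open>
  The remainder is governed by the derivative of order \<open>M + 1\<close> of \<open>z powr a\<close> on the real segment
  between the two points. The hypothesis makes the exponent of that derivative nonpositive in its
  real part, so that the derivative is largest at the left end.
\<close>
lemma norm_powr_taylor_rem_le:
  assumes "Re a \<le> real M + 1"
  shows "norm (powr_taylor_rem M a n)
           \<le> (real M + 1) * norm (a gchoose Suc M) * real (Suc n) powr (Re a - real M - 1)"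
proof -
  define S where "S = complex_of_real ` {real (Suc n)..real (Suc (Suc n))}"
  define f where "f i z = fact i * (a gchoose i) * z powr (a - of_nat i)" for i and z :: complex
  define B where "B = fact (Suc M) * norm (a gchoose Suc M) * real (Suc n) powr (Re a - real M - 1)"
  have S_pos: "\<exists>t. z = of_real t \<and> t \<ge> real (Suc n)" if "z \<in> S" for z
    using that by (auto simp: S_def)
  have "norm (f 0 (of_nat (Suc (Suc n))) -
          (\<Sum>i\<le>M. f i (of_nat (Suc n)) * (of_nat (Suc (Suc n)) - of_nat (Suc n)) ^ i / fact i))
        \<le> B * norm (of_nat (Suc (Suc n)) - of_nat (Suc n) :: complex) ^ Suc M / fact M"
  proof (rule complex_Taylor[where S = S])
    show "convex S"
      unfolding S_def by (intro convex_linear_image) (auto simp: linear_iff scaleR_conv_of_real)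
    show "(f i has_field_derivative f (Suc i) z) (at z within S)" if zS: "z \<in> S" for i z
    proof -
      obtain t where t: "z = of_real t" "t \<ge> real (Suc n)" using S_pos[OF zS] by blast
      then have z: "z \<notin> \<real>\<^sub>\<le>\<^sub>0" by (auto simp: complex_nonpos_Reals_iff)
      have "(f i has_field_derivative
               fact i * (a gchoose i) * ((a - of_nat i) * z powr (a - of_nat i - 1))) (at z within S)"
        unfolding f_def by (auto intro!: derivative_eq_intros z)
      also have "fact i * (a gchoose i) * ((a - of_nat i) * z powr (a - of_nat i - 1)) = f (Suc i) z"
        unfolding f_def gbinomial_Suc_absorb by (simp add: mult_ac diff_diff_eq add.commute)
      finally show ?thesis .
    qed
    show "norm (f (Suc M) z) \<le> B" if zS: "z \<in> S" for z
    proof -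
      obtain t where t: "z = of_real t" "t \<ge> real (Suc n)" using S_pos[OF zS] by blast
      have "norm (z powr (a - of_nat (Suc M))) = t powr (Re a - real M - 1)"
        using norm_powr_real_powr[of z "a - of_nat (Suc M)"] t by (simp add: algebra_simps norm_powr_real_powr')
      also have "\<dots> \<le> real (Suc n) powr (Re a - real M - 1)"
        using t assms by (intro powr_mono2') auto
      finally show ?thesis
        unfolding f_def B_def norm_mult by (intro mult_mono) (auto simp: norm_fact simp del: fact_Suc)
    qed
    show "of_nat (Suc n) \<in> S"
      unfolding S_def by (rule image_eqI[of _ _ "real (Suc n)"]) auto
    show "of_nat (Suc (Suc n)) \<in> S"
      unfolding S_def by (rule image_eqI[of _ _ "real (Suc (Suc n))"]) auto
  qed
  also have "norm (of_nat (Suc (Suc n)) - of_nat (Suc n) :: complex) = 1"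
    by simp
  also have "(of_nat (Suc (Suc n)) - of_nat (Suc n) :: complex) = 1"
    by simp
  also have "f 0 (of_nat (Suc (Suc n))) - (\<Sum>i\<le>M. f i (of_nat (Suc n)) * 1 ^ i / fact i)
               = powr_taylor_rem M a n"
    by (simp add: f_def powr_taylor_rem_def)
  also have "B * 1 ^ Suc M / fact M
               = (real M + 1) * norm (a gchoose Suc M) * real (Suc n) powr (Re a - real M - 1)"
    by (simp add: B_def field_simps)
  finally show ?thesis .
qed

lemma summable_Suc_powr:
  assumes "p < -1"
  shows "summable (\<lambda>n. real (Suc n) powr p)"
  using assms summable_real_powr_iff[of p] summable_Suc_iff[of "\<lambda>n. real n powr p"] by simp

lemma summable_of_powr_bound:
  fixes a :: "nat \<Rightarrow> 'a :: banach"
  assumes "\<And>n. norm (a n) \<le> B * real (Suc n) powr p" "p < -1"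
  shows "summable a"
  using summable_mult[OF summable_Suc_powr[OF assms(2)], of B] assms(1)
  by (rule summable_comparison_test')

text \<open>
  The Weierstrass M-test on small discs: on a disc around \<open>z\<close> whose radius is half of the
  distance to the boundary of the half-plane, the exponents of the bounds stay below \<open>- 1\<close>.
\<close>
lemma holomorphic_suminf_powr_bound:
  fixes a :: "nat \<Rightarrow> complex \<Rightarrow> complex" and B :: "complex \<Rightarrow> real"
  assumes hol: "\<And>n. a n holomorphic_on {s. Re s > 1 - M}"
    and B: "continuous_on UNIV B"
    and bound: "\<And>n s. Re s > 1 - M \<Longrightarrow> norm (a n s) \<le> B s * real (Suc n) powr (- Re s - M)"
  shows "(\<lambda>s. \<Sum>n. a n s) holomorphic_on {s. Re s > 1 - M}"
proof (rule holomorphic_uniform_sequence)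
  show "open {s. Re s > 1 - M}" by (rule open_halfspace_Re_gt)
  show "(\<lambda>s. \<Sum>n<N. a n s) holomorphic_on {s. Re s > 1 - M}" for N
    by (intro holomorphic_intros hol)
  fix z assume "z \<in> {s. Re s > 1 - M}"
  then have z: "Re z > 1 - M" by simp
  define d where "d = (Re z - (1 - M)) / 2"
  have d: "d > 0" using z by (simp add: d_def)
  have Re_ge: "Re s \<ge> Re z - d" if "s \<in> cball z d" for s
    using that abs_Re_le_cmod[of "z - s"] by (auto simp: dist_norm)
  have Re_gt: "Re s > 1 - M" if "s \<in> cball z d" for s
    using Re_ge[OF that] d by (simp add: d_def field_simps)
  have "bounded (B ` cball z d)"
    by (intro compact_imp_bounded compact_continuous_image continuous_on_subset[OF B]) auto
  then obtain C where C: "\<And>s. s \<in> cball z d \<Longrightarrow> \<bar>B s\<bar> \<le> C"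
    unfolding bounded_iff by (metis image_eqI real_norm_def)
  have "uniform_limit (cball z d) (\<lambda>N s. \<Sum>n<N. a n s) (\<lambda>s. \<Sum>n. a n s) sequentially"
  proof (rule Weierstrass_m_test)
    show "norm (a n s) \<le> C * real (Suc n) powr (- (Re z - d) - M)" if "s \<in> cball z d" for n s
    proof -
      have "norm (a n s) \<le> B s * real (Suc n) powr (- Re s - M)"
        by (rule bound[OF Re_gt[OF that]])
      also have "\<dots> \<le> C * real (Suc n) powr (- (Re z - d) - M)"
        using C[OF that] Re_ge[OF that] by (intro mult_mono powr_mono) auto
      finally show ?thesis .
    qed
    show "summable (\<lambda>n. C * real (Suc n) powr (- (Re z - d) - M))"
      by (intro summable_mult summable_Suc_powr) (use d in \<open>simp add: d_def field_simps\<close>)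
  qed
  then show "\<exists>d>0. cball z d \<subseteq> {s. Re s > 1 - M} \<and>
      uniform_limit (cball z d) (\<lambda>N s. \<Sum>n<N. a n s) (\<lambda>s. \<Sum>n. a n s) sequentially"
    using d Re_gt by blast
qed

lemma holomorphic_on_gbinomial [holomorphic_intros]:
  assumes "f holomorphic_on A"
  shows "(\<lambda>z. f z gchoose k) holomorphic_on A"
  unfolding gbinomial_prod_rev by (intro holomorphic_intros assms) auto

lemma holomorphic_on_powr_taylor_rem:
  assumes "f holomorphic_on A"
  shows "(\<lambda>s. powr_taylor_rem M (f s) n) holomorphic_on A"
proof -
  have "of_nat (Suc n) \<notin> (\<real>\<^sub>\<le>\<^sub>0 :: complex set)" for n
    by (simp add: complex_nonpos_Reals_iff)
  then show ?thesis
    unfolding powr_taylor_rem_def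
    by (intro holomorphic_intros assms) auto
qed

lemma holomorphic_suminf_powr_taylor_rem:
  "(\<lambda>s. \<Sum>n. powr_taylor_rem M (1 - s) n) holomorphic_on {s. Re s > 1 - real M}"
proof (rule holomorphic_suminf_powr_bound)
  show "(\<lambda>s. powr_taylor_rem M (1 - s) n) holomorphic_on {s. Re s > 1 - real M}" for n
    by (intro holomorphic_on_powr_taylor_rem holomorphic_intros)
  show "continuous_on UNIV (\<lambda>s :: complex. (real M + 1) * norm (1 - s gchoose Suc M))"
    by (intro continuous_intros holomorphic_on_imp_continuous_on holomorphic_intros)
  show "norm (powr_taylor_rem M (1 - s) n)
          \<le> (real M + 1) * norm (1 - s gchoose Suc M) * real (Suc n) powr (- Re s - real M)"
    if "Re s > 1 - real M" for n s
    using norm_powr_taylor_rem_le[of "1 - s" M n] that by (simp add: algebra_simps)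
qed

text \<open>
  A continuation of \<open>(s - 1) \<zeta>(s)\<close> to \<open>H\<close>. The factor \<open>s - 1\<close> removes the pole, so that no points
  have to be taken out of \<open>H\<close>; in the recursion below this also disposes of the poles of
  \<open>\<zeta>(s + k)\<close> at \<open>s = 1 - k\<close>.
\<close>
definition zeta_mult_on :: "complex set \<Rightarrow> (complex \<Rightarrow> complex) \<Rightarrow> bool" where
  "zeta_mult_on H Z \<longleftrightarrow> Z holomorphic_on H \<and>
     (\<forall>s. Re s > 1 \<longrightarrow> (\<lambda>n. of_nat (Suc n) powr - s) sums (Z s / (s - 1)))"

lemma tendsto_of_nat_Suc_powr_0:
  fixes z :: complex
  assumes "Re z < 0"
  shows "(\<lambda>n. of_nat (Suc n) powr z) \<longlonglongrightarrow> 0"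
proof (rule tendsto_norm_zero_cancel)
  have "(\<lambda>n. real (Suc n) powr Re z) \<longlonglongrightarrow> 0"
    using assms by real_asymp
  then show "(\<lambda>n. norm (of_nat (Suc n) powr z)) \<longlonglongrightarrow> 0"
    by (simp only: norm_of_nat_Suc_powr)
qed

lemma zeta_mult_on_Re_gt_1: "\<exists>Z. zeta_mult_on {s. Re s > 1} Z"
proof -
  define Z where "Z s = (s - 1) * (\<Sum>n. of_nat (Suc n) powr - s)" for s :: complex
  have *: "of_nat (Suc n) \<notin> (\<real>\<^sub>\<le>\<^sub>0 :: complex set)" for n
    by (simp add: complex_nonpos_Reals_iff)
  have "(\<lambda>s. \<Sum>n. of_nat (Suc n) powr - s) holomorphic_on {s. Re s > 1 - 0}"
    by (rule holomorphic_suminf_powr_bound[where B = "\<lambda>_. 1"])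
       (use * in \<open>auto intro!: holomorphic_intros simp: norm_of_nat_Suc_powr simp del: of_nat_Suc\<close>)
  then have "Z holomorphic_on {s. Re s > 1}"
    unfolding Z_def by (intro holomorphic_intros) auto
  moreover have "(\<lambda>n. of_nat (Suc n) powr - s) sums (Z s / (s - 1))" if "Re s > 1" for s
  proof -
    have "summable (\<lambda>n. of_nat (Suc n) powr - s)"
      by (rule summable_of_powr_bound[where B = 1 and p = "- Re s"])
         (use that in \<open>auto simp: norm_of_nat_Suc_powr simp del: of_nat_Suc\<close>)
    moreover have "s \<noteq> 1" using that by auto
    ultimately show ?thesis by (simp add: Z_def sums_iff)
  qed
  ultimately show ?thesis unfolding zeta_mult_on_def by blast
qed

text \<open>
  The binomial coefficient in front of \<open>\<zeta>(s + i)\<close> in the recursion vanishes at the pole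
  \<open>s = 1 - i\<close> of that term; this is the coefficient after the cancellation.
\<close>
lemma gchoose_Suc_minus:
  fixes s :: complex
  assumes "s + of_nat i \<noteq> 1"
  shows "(1 - s gchoose Suc i) / (s + of_nat i - 1) = - (1 - s gchoose i) / of_nat (Suc i)"
proof -
  have *: "of_nat (Suc i) * (1 - s gchoose Suc i) = (1 - s gchoose i) * (1 - s - of_nat i)"
    using gbinomial_mult_1[of "1 - s" i] by (simp add: algebra_simps)
  then have "1 - s gchoose Suc i = (1 - s gchoose i) * (1 - s - of_nat i) / of_nat (Suc i)"
    by (simp add: field_simps del: of_nat_Suc)
  moreover have "1 - s - of_nat i = - (s + of_nat i - 1)" "s + of_nat i - 1 \<noteq> 0"
    using assms by (simp_all add: algebra_simps)
  ultimately show ?thesis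
    by (simp only: mult_minus_right) (simp add: divide_simps)
qed

text \<open>
  For \<open>Re s > 1\<close>, summing the Taylor expansion of \<open>(n + 1) powr a\<close> with \<open>a = 1 - s\<close> over
  \<open>n \<ge> 1\<close> and telescoping gives
  \<open>- 1 = (1 - s) \<zeta>(s) + (\<Sum>i=1..K. (a gchoose (i + 1)) \<zeta>(s + i)) + R s\<close>.
  All terms except the first one make sense one unit further to the left than \<open>Z\<close> is known, and so
  define the new function there.
\<close>
lemma zeta_mult_on_step:
  assumes "zeta_mult_on {s. Re s > 1 - real K} Z"
  shows "\<exists>Z'. zeta_mult_on {s. Re s > 1 - real (Suc K)} Z'"
proof -
  define H where "H = {s. Re s > 1 - real (Suc K)}"
  have Z_hol: "Z holomorphic_on {s. Re s > 1 - real K}"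
    and Z_sums: "\<And>s. Re s > 1 \<Longrightarrow> (\<lambda>n. of_nat (Suc n) powr - s) sums (Z s / (s - 1))"
    using assms by (auto simp: zeta_mult_on_def)
  define R where "R s = (\<Sum>n. powr_taylor_rem (Suc K) (1 - s) n)" for s
  define Z' where "Z' s = 1 - (\<Sum>i=1..K. (1 - s gchoose i) / of_nat (Suc i) * Z (s + of_nat i)) + R s"
    for s :: complex
  have "R holomorphic_on H"
    unfolding R_def H_def by (rule holomorphic_suminf_powr_taylor_rem)
  moreover have "(\<lambda>s. Z (s + of_nat i)) holomorphic_on H" if "i \<in> {1..K}" for i
    using that
    by (intro holomorphic_on_compose_gen[OF _ Z_hol, unfolded o_def] holomorphic_intros)
       (auto simp: H_def)
  ultimately have "Z' holomorphic_on H"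
    unfolding Z'_def by (intro holomorphic_intros) auto
  moreover have "(\<lambda>n. of_nat (Suc n) powr - s) sums (Z' s / (s - 1))" if s: "Re s > 1" for s
  proof -
    define a where "a = 1 - s"
    have ne: "s + of_nat i \<noteq> 1" for i using s by (auto simp: complex_eq_iff)
    have "summable (powr_taylor_rem (Suc K) a)"
    proof (rule summable_of_powr_bound)
      show "norm (powr_taylor_rem (Suc K) a n) \<le>
        (real (Suc K) + 1) * norm (a gchoose Suc (Suc K)) * real (Suc n) powr (Re a - real (Suc K) - 1)" for n
        by (rule norm_powr_taylor_rem_le) (use s in \<open>auto simp: a_def\<close>)
    qed (use s in \<open>auto simp: a_def\<close>)
    then have R: "powr_taylor_rem (Suc K) a sums R s"
      by (simp add: R_def a_def summable_sums)
    have tele: "(\<lambda>n. of_nat (Suc (Suc n)) powr a - of_nat (Suc n) powr a) sums (0 - of_nat (Suc 0) powr a)"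
      by (rule telescope_sums[OF tendsto_of_nat_Suc_powr_0]) (use s in \<open>simp add: a_def\<close>)
    have term_sums: "(\<lambda>n. (a gchoose Suc i) * of_nat (Suc n) powr (a - of_nat (Suc i))) sums
             ((a gchoose Suc i) * (Z (s + of_nat i) / (s + of_nat i - 1)))" for i
    proof -
      have "a - of_nat (Suc i) = - (s + of_nat i)" by (simp add: a_def)
      then show ?thesis using s by (simp only:) (intro sums_mult Z_sums, simp)
    qed
    have sums_K: "(\<lambda>n. (of_nat (Suc (Suc n)) powr a - of_nat (Suc n) powr a) - powr_taylor_rem (Suc K) a n
             - (\<Sum>i=1..K. (a gchoose Suc i) * of_nat (Suc n) powr (a - of_nat (Suc i))))
          sums ((0 - of_nat (Suc 0) powr a) - R s
             - (\<Sum>i=1..K. (a gchoose Suc i) * (Z (s + of_nat i) / (s + of_nat i - 1))))"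
      by (intro sums_diff tele R sums_sum term_sums)
    \<comment> \<open>The terms of orders \<open>0\<close> and \<open>1\<close> are the telescoping part and the multiple of \<open>\<zeta>(s)\<close>.\<close>
    have split_sum: "(\<Sum>i\<le>Suc K. t i) = t 0 + t 1 + (\<Sum>i=1..K. t (Suc i))" for t :: "nat \<Rightarrow> complex"
      by (simp only: sum.atMost_Suc_shift) (simp add: atMost_atLeast0 sum.atLeast_Suc_atMost)
    note sums_K
    also have "(\<lambda>n. (of_nat (Suc (Suc n)) powr a - of_nat (Suc n) powr a) - powr_taylor_rem (Suc K) a n
             - (\<Sum>i=1..K. (a gchoose Suc i) * of_nat (Suc n) powr (a - of_nat (Suc i))))
          = (\<lambda>n. a * of_nat (Suc n) powr (- s))"
    proof
      fix n
      have "(\<Sum>i\<le>Suc K. (a gchoose i) * of_nat (Suc n) powr (a - of_nat i)) =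
          of_nat (Suc n) powr a + a * of_nat (Suc n) powr (a - 1) +
          (\<Sum>i=1..K. (a gchoose Suc i) * of_nat (Suc n) powr (a - of_nat (Suc i)))"
        using split_sum[of "\<lambda>i. (a gchoose i) * of_nat (Suc n) powr (a - of_nat i)"] by simp
      moreover have "a - 1 = - s" by (simp add: a_def)
      ultimately show "(of_nat (Suc (Suc n)) powr a - of_nat (Suc n) powr a) - powr_taylor_rem (Suc K) a n
             - (\<Sum>i=1..K. (a gchoose Suc i) * of_nat (Suc n) powr (a - of_nat (Suc i)))
          = a * of_nat (Suc n) powr (- s)"
        by (simp add: powr_taylor_rem_def)
    qed
    also have "(\<lambda>i. (a gchoose Suc i) * (Z (s + of_nat i) / (s + of_nat i - 1)))
                 = (\<lambda>i. - ((1 - s gchoose i) / of_nat (Suc i) * Z (s + of_nat i)))"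
    proof
      fix i
      have "(a gchoose Suc i) * (Z (s + of_nat i) / (s + of_nat i - 1))
              = (1 - s gchoose Suc i) / (s + of_nat i - 1) * Z (s + of_nat i)"
        by (simp add: a_def)
      then show "(a gchoose Suc i) * (Z (s + of_nat i) / (s + of_nat i - 1))
                   = - ((1 - s gchoose i) / of_nat (Suc i) * Z (s + of_nat i))"
        by (simp only: gchoose_Suc_minus[OF ne]) simp
    qed
    also have "((0 - of_nat (Suc 0) powr a) - R s
             - (\<Sum>i=1..K. - ((1 - s gchoose i) / of_nat (Suc i) * Z (s + of_nat i)))) = - Z' s"
      by (simp add: Z'_def sum_negf)
    finally have "(\<lambda>n. a * of_nat (Suc n) powr (- s)) sums (- Z' s)" .
    from sums_divide[OF this, of a] have "(\<lambda>n. of_nat (Suc n) powr (- s)) sums (- Z' s / a)"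
      using ne[of 0] by (simp add: a_def del: of_nat_Suc)
    also have "- Z' s / a = Z' s / (s - 1)"
      using ne[of 0] by (simp add: a_def divide_simps) (simp add: algebra_simps)
    finally show ?thesis .
  qed
  ultimately show ?thesis
    unfolding zeta_mult_on_def H_def by blast
qed

lemma zeta_mult_on_half_plane: "\<exists>Z. zeta_mult_on {s. Re s > 1 - real K} Z"
proof (induction K)
  case 0
  then show ?case using zeta_mult_on_Re_gt_1 by simp
next
  case (Suc K)
  then show ?case using zeta_mult_on_step by blast
qed

text \<open>
  By the identity theorem the continuations to the nested half-planes agree where both are defined,
  and so they glue to an entire function.
\<close>
lemma ex_zeta_mult_on_UNIV: "\<exists>Z. zeta_mult_on UNIV Z"
proof -
  define H where "H K = {s. Re s > 1 - real K}" for K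
  obtain Z where Z: "\<And>K. zeta_mult_on (H K) (Z K)"
    using zeta_mult_on_half_plane unfolding H_def by metis
  have H_mono: "H J \<subseteq> H K" if "J \<le> K" for J K using that by (auto simp: H_def)
  have agree: "Z J s = Z K s" if JK: "J \<le> K" "s \<in> H J" for J K s
  proof (rule analytic_continuation_open[of "{s. Re s > 1}" "H J" "Z J" "Z K"])
    show "connected (H J)" unfolding H_def by (intro convex_connected convex_halfspace_Re_gt)
    show "{s. Re s > 1} \<noteq> {}" by (auto intro!: exI[of _ 2])
    show "Z J holomorphic_on H J" using Z by (auto simp: zeta_mult_on_def)
    show "Z K holomorphic_on H J"
      using Z[of K] H_mono[OF JK(1)] holomorphic_on_subset by (metis zeta_mult_on_def)
    show "Z J z = Z K z" if "z \<in> {s. Re s > 1}" for z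
    proof -
      have "z \<noteq> 1" using that by auto
      moreover have "Z J z / (z - 1) = Z K z / (z - 1)"
        by (rule sums_unique2) (use that Z in \<open>auto simp: zeta_mult_on_def\<close>)
      ultimately show ?thesis by simp
    qed
  qed (use that in \<open>auto simp: H_def open_halfspace_Re_gt\<close>)
  define level where "level s = nat \<lceil>1 - Re s\<rceil> + 1" for s
  have level: "s \<in> H (level s)" for s
    unfolding level_def H_def by simp linarith
  define Z' where "Z' s = Z (level s) s" for s
  have Z'_eq: "Z' s = Z K s" if "s \<in> H K" for K s
  proof (cases "K \<le> level s")
    case True
    then show ?thesis using agree[OF True that] by (simp add: Z'_def)
  next
    case False
    then have "level s \<le> K" by simp
    from agree[OF this level] show ?thesis by (simp add: Z'_def)
  qed
  have "Z' holomorphic_on (\<Union>K. H K)"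
  proof (rule holomorphic_on_UN_open)
    show "Z' holomorphic_on H K" for K
    proof -
      have "Z K holomorphic_on H K" using Z[of K] by (simp add: zeta_mult_on_def)
      then show ?thesis by (rule holomorphic_transform) (simp add: Z'_eq)
    qed
    show "open (H K)" for K by (simp add: H_def open_halfspace_Re_gt)
  qed
  also have "(\<Union>K. H K) = UNIV" using level by blast
  finally have "Z' holomorphic_on UNIV" .
  moreover have "(\<lambda>n. of_nat (Suc n) powr - s) sums (Z' s / (s - 1))" if "Re s > 1" for s
    using Z[of 0] Z'_eq[of s 0] that by (auto simp: zeta_mult_on_def H_def)
  ultimately show ?thesis by (auto simp: zeta_mult_on_def)
qed

text \<open>
  The existence of a continuation is exactly what the choice in the definition of \<open>zeta\<close> requires.
\<close>
lemma zeta_holomorphic: "zeta holomorphic_on - {1}"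
  and zeta_sums: "Re s > 1 \<Longrightarrow> (\<lambda>n. of_nat (Suc n) powr - s) sums zeta s"
proof -
  obtain Z where Z: "zeta_mult_on UNIV Z" using ex_zeta_mult_on_UNIV by blast
  have "\<exists>f. f holomorphic_on - {1} \<and>
     (\<forall>s. Re s > 1 \<longrightarrow> (\<lambda>n. 1 / of_nat (Suc n) powr s) sums f s)"
  proof (intro exI[of _ "\<lambda>s. Z s / (s - 1)"] conjI allI impI)
    show "(\<lambda>s. Z s / (s - 1)) holomorphic_on - {1}"
      using Z by (auto simp: zeta_mult_on_def intro!: holomorphic_intros intro: holomorphic_on_subset)
    show "(\<lambda>n. 1 / of_nat (Suc n) powr s) sums (Z s / (s - 1))" if "Re s > 1" for s
      using Z that by (auto simp: zeta_mult_on_def powr_minus_divide)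
  qed
  from someI_ex[OF this]
  show "zeta holomorphic_on - {1}" "Re s > 1 \<Longrightarrow> (\<lambda>n. of_nat (Suc n) powr - s) sums zeta s"
    unfolding zeta_def by (auto simp: powr_minus_divide)
qed

section \<open>Partial sums of the Dirichlet series left of the line Re s = 1\<close>

text \<open>
  By the mean value theorem the summand is at most \<open>c\<close> times the difference of consecutive values of
  \<open>t powr (p + 1)\<close>, and those differences telescope. The factor \<open>2 powr (- p)\<close> in \<open>c\<close> pays for
  replacing the intermediate point, which is below \<open>t + 1 \<le> 2 t\<close>, by \<open>t\<close>.
\<close>
lemma suminf_Suc_powr_tail_le:
  assumes "p < -1"
  shows "(\<Sum>k. real (Suc (k + M)) powr p) \<le> 2 powr (- p) / (- p - 1) * real (Suc M) powr (p + 1)"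
proof -
  define q where "q = p + 1"
  have q: "q < 0" using assms by (simp add: q_def)
  define c where "c = 2 powr (- p) / (- p - 1)"
  have "c = 2 powr (- p) / (- q)" by (simp add: c_def q_def)
  then have c: "c * (- q) = 2 powr (- p)" using q by simp
  have tele: "(\<lambda>k. real (Suc (k + M)) powr q - real (Suc (Suc k + M)) powr q)
               sums (real (Suc (0 + M)) powr q - 0)"
  proof (rule telescope_sums'[where f = "\<lambda>k. real (Suc (k + M)) powr q"])
    show "(\<lambda>k. real (Suc (k + M)) powr q) \<longlonglongrightarrow> 0" using q by real_asymp
  qed
  have le: "real (Suc (k + M)) powr p \<le> c * (real (Suc (k + M)) powr q - real (Suc (Suc k + M)) powr q)" for k
  proof -
    define t where "t = real (Suc (k + M))"
    have t: "t \<ge> 1" by (simp add: t_def)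
    have "\<exists>\<xi>. t < \<xi> \<and> \<xi> < t + 1 \<and> (t + 1) powr q - t powr q = (t + 1 - t) * (q * \<xi> powr (q - 1))"
      by (rule MVT2) (use t in \<open>auto intro!: derivative_eq_intros\<close>)
    then obtain \<xi> where \<xi>: "t < \<xi>" "\<xi> < t + 1" "(t + 1) powr q - t powr q = q * \<xi> powr p"
      by (auto simp: q_def)
    have "(2 * t) powr p \<le> \<xi> powr p"
      using \<xi> t assms by (intro powr_mono2') auto
    then have "2 powr (- p) * (2 powr p * t powr p) \<le> 2 powr (- p) * \<xi> powr p"
      using t by (simp add: powr_mult)
    then have "t powr p \<le> 2 powr (- p) * \<xi> powr p"
      by (simp add: powr_minus field_simps)
    also have "\<dots> = c * (t powr q - (t + 1) powr q)"
    proof -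
      have "t powr q - (t + 1) powr q = (- q) * \<xi> powr p" using \<xi>(3) by simp
      then show ?thesis by (simp only: mult.assoc[symmetric] c)
    qed
    finally show ?thesis by (simp add: t_def add_ac)
  qed
  have "summable (\<lambda>k. real (Suc (k + M)) powr p)"
    using summable_ignore_initial_segment[OF summable_Suc_powr[OF assms], of M] by simp
  then have "(\<Sum>k. real (Suc (k + M)) powr p) \<le> c * (real (Suc (0 + M)) powr q - 0)"
    using sums_le[OF le summable_sums sums_mult[OF tele, of c]] by blast
  then show ?thesis by (simp add: c_def q_def)
qed

lemma norm_suminf_diff_partial_le:
  fixes a :: "nat \<Rightarrow> 'a :: banach"
  assumes a: "\<And>n. norm (a n) \<le> B * real (Suc n) powr p" and p: "p < -1"
  shows "norm ((\<Sum>n. a n) - (\<Sum>n<M. a n)) \<le> B * (2 powr (- p) / (- p - 1)) * real (Suc M) powr (p + 1)"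
proof -
  have B: "B \<ge> 0" using order_trans[OF norm_ge_zero a[of 0]] by simp
  have sum_a: "summable a" by (rule summable_of_powr_bound[OF a p])
  have sum_p: "summable (\<lambda>k. B * real (Suc (k + M)) powr p)"
    using summable_mult[OF summable_ignore_initial_segment[OF summable_Suc_powr[OF p], of M]] by simp
  have "(\<Sum>n. a n) - (\<Sum>n<M. a n) = (\<Sum>k. a (k + M))"
    using suminf_minus_initial_segment[OF sum_a] by simp
  also have "norm \<dots> \<le> (\<Sum>k. B * real (Suc (k + M)) powr p)"
    using norm_suminf_le[OF a sum_p] by simp
  also have "\<dots> = B * (\<Sum>k. real (Suc (k + M)) powr p)"
    using summable_ignore_initial_segment[OF summable_Suc_powr[OF p], of M] by (intro suminf_mult) simp
  also have "\<dots> \<le> B * (2 powr (- p) / (- p - 1) * real (Suc M) powr (p + 1))"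
    by (intro mult_left_mono suminf_Suc_powr_tail_le p B)
  finally show ?thesis by (simp add: mult_ac)
qed

text \<open>
  The error of the trapezoidal rule for the integral of \<open>t powr - s\<close> over \<open>{n + 1..n + 2}\<close>, multiplied by
  \<open>s - 1\<close> in order to be an entire function of \<open>s\<close>.
\<close>
definition trapezoid_defect :: "nat \<Rightarrow> complex \<Rightarrow> complex" where
  "trapezoid_defect n s = of_nat (Suc (Suc n)) powr (1 - s) - of_nat (Suc n) powr (1 - s)
     + (s - 1) / 2 * (of_nat (Suc n) powr - s + of_nat (Suc (Suc n)) powr - s)"

text \<open>
  The trapezoidal rule cancels the terms of the Taylor expansion of orders \<open>0\<close>, \<open>1\<close> and \<open>2\<close>,
  so only remainders of size \<open>n powr (- Re s - 2)\<close> are left.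
\<close>
lemma trapezoid_defect_conv_rem:
  "trapezoid_defect n s = powr_taylor_rem 2 (1 - s) n + (s - 1) / 2 * powr_taylor_rem 1 (- s) n"
proof -
  have one: "of_nat (Suc 0) = (1 :: complex)" by simp
  have e2: "1 - s - of_nat (Suc (Suc 0)) = - s - 1" by simp
  have c: "(1 - s gchoose 2) = (1 - s) * (- s) / 2"
    by (simp add: gbinomial_prod_rev numeral_2_eq_2)
  have r2: "powr_taylor_rem 2 (1 - s) n = of_nat (Suc (Suc n)) powr (1 - s) - (of_nat (Suc n) powr (1 - s)
      + (1 - s) * of_nat (Suc n) powr - s + (1 - s gchoose 2) * of_nat (Suc n) powr (- s - 1))"
    unfolding powr_taylor_rem_def by (simp add: eval_nat_numeral e2 one del: of_nat_Suc)
  have r1: "powr_taylor_rem 1 (- s) n = of_nat (Suc (Suc n)) powr - s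
      - (of_nat (Suc n) powr - s + (- s) * of_nat (Suc n) powr (- s - 1))"
    unfolding powr_taylor_rem_def by (simp add: one del: of_nat_Suc)
  have "P - Q + (s - 1) / 2 * (q + p)
      = P - (Q + (1 - s) * q + (1 - s) * (- s) / 2 * r) + (s - 1) / 2 * (p - (q + (- s) * r))"
    for P Q p q r :: complex
    by (simp add: algebra_simps add_divide_distrib diff_divide_distrib)
  then show ?thesis
    unfolding trapezoid_defect_def r1 r2 c by blast
qed

definition trapezoid_bound :: "complex \<Rightarrow> real" where
  "trapezoid_bound s = 3 * norm (1 - s gchoose 3) + norm (s - 1) * norm (- s gchoose 2)"

lemma norm_trapezoid_defect_le:
  assumes "Re s > -1"
  shows "norm (trapezoid_defect n s) \<le> trapezoid_bound s * real (Suc n) powr (- Re s - 2)"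
proof -
  have "norm (powr_taylor_rem 2 (1 - s) n) \<le> 3 * norm (1 - s gchoose 3) * real (Suc n) powr (- Re s - 2)"
    using norm_powr_taylor_rem_le[of "1 - s" 2 n] assms by (simp add: eval_nat_numeral algebra_simps)
  moreover have "norm (powr_taylor_rem 1 (- s) n) \<le> 2 * norm (- s gchoose 2) * real (Suc n) powr (- Re s - 2)"
    using norm_powr_taylor_rem_le[of "- s" 1 n] assms by (simp add: numeral_2_eq_2 algebra_simps)
  then have "norm ((s - 1) / 2 * powr_taylor_rem 1 (- s) n)
      \<le> norm (s - 1) / 2 * (2 * norm (- s gchoose 2) * real (Suc n) powr (- Re s - 2))"
    unfolding norm_mult norm_divide by (intro mult_mono) auto
  ultimately show ?thesis
    unfolding trapezoid_defect_conv_rem trapezoid_bound_def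
    by (intro order_trans[OF norm_triangle_ineq]) (simp add: algebra_simps)
qed

text \<open>
  For \<open>Re s > 1\<close> both sides agree by telescoping. The series of defects converges locally uniformly
  for \<open>Re s > - 1\<close>, and that half-plane stays connected when the point \<open>1\<close> is removed, so the
  identity theorem extends the equation.
\<close>
lemma zeta_eq_suminf_trapezoid_defect:
  assumes "Re s > -1" "s \<noteq> 1"
  shows "(s - 1) * zeta s = 1 + (s - 1) / 2 + (\<Sum>n. trapezoid_defect n s)"
proof -
  define H where "H = {s. Re s > 1 - 2} - {1 :: complex}"
  have pos: "of_nat (Suc n) \<notin> (\<real>\<^sub>\<le>\<^sub>0 :: complex set)" for n
    by (simp add: complex_nonpos_Reals_iff)
  have hol: "(\<lambda>s. \<Sum>n. trapezoid_defect n s) holomorphic_on {s. Re s > 1 - 2}"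
  proof (rule holomorphic_suminf_powr_bound)
    show "trapezoid_defect n holomorphic_on {s. Re s > 1 - 2}" for n
      unfolding trapezoid_defect_def using pos by (intro holomorphic_intros) auto
    show "continuous_on UNIV trapezoid_bound"
      unfolding trapezoid_bound_def
      by (intro continuous_intros holomorphic_on_imp_continuous_on holomorphic_intros)
    show "norm (trapezoid_defect n s) \<le> trapezoid_bound s * real (Suc n) powr (- Re s - 2)"
      if "Re s > 1 - 2" for n s
      by (rule norm_trapezoid_defect_le) (use that in simp)
  qed
  show ?thesis
  proof (rule analytic_continuation_open[of "{s. Re s > 1}" H
        "\<lambda>s. (s - 1) * zeta s" "\<lambda>s. 1 + (s - 1) / 2 + (\<Sum>n. trapezoid_defect n s)"])
    show "open H"
      unfolding H_def by (intro open_delete open_halfspace_Re_gt)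
    show "connected H"
      unfolding H_def
      by (intro connected_open_delete open_halfspace_Re_gt convex_connected convex_halfspace_Re_gt) auto
    show "{s. Re s > 1} \<noteq> {}" by (auto intro!: exI[of _ 2])
    have "zeta holomorphic_on H"
      by (rule holomorphic_on_subset[OF zeta_holomorphic]) (auto simp: H_def)
    then show "(\<lambda>s. (s - 1) * zeta s) holomorphic_on H"
      by (intro holomorphic_intros)
    have "(\<lambda>s. \<Sum>n. trapezoid_defect n s) holomorphic_on H"
      by (rule holomorphic_on_subset[OF hol]) (auto simp: H_def)
    then show "(\<lambda>s. 1 + (s - 1) / 2 + (\<Sum>n. trapezoid_defect n s)) holomorphic_on H"
      by (intro holomorphic_intros) auto
    show "(z - 1) * zeta z = 1 + (z - 1) / 2 + (\<Sum>n. trapezoid_defect n z)" if "z \<in> {s. Re s > 1}" for z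
    proof -
      have z: "Re z > 1" using that by simp
      have "(\<lambda>n. of_nat (Suc (Suc n)) powr (1 - z) - of_nat (Suc n) powr (1 - z))
              sums (0 - of_nat (Suc 0) powr (1 - z))"
        by (rule telescope_sums[OF tendsto_of_nat_Suc_powr_0]) (use z in simp)
      moreover have "(\<lambda>n. of_nat (Suc (Suc n)) powr - z) sums (zeta z - of_nat (Suc 0) powr - z)"
        using zeta_sums[OF z] by (subst sums_Suc_iff) simp
      ultimately have "(\<lambda>n. trapezoid_defect n z) sums
         ((0 - of_nat (Suc 0) powr (1 - z)) + (z - 1) / 2 * (zeta z + (zeta z - of_nat (Suc 0) powr - z)))"
        unfolding trapezoid_defect_def by (intro sums_add sums_mult zeta_sums z)
      then show ?thesis by (simp add: sums_iff field_simps)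
    qed
  qed (use assms in \<open>auto simp: H_def open_halfspace_Re_gt\<close>)
qed

lemma sum_trapezoid_defect:
  "(\<Sum>n<M. trapezoid_defect n s) = of_nat (Suc M) powr (1 - s) - 1 - (s - 1) / 2
     + (s - 1) * ((\<Sum>n<M. of_nat (Suc n) powr - s) + of_nat (Suc M) powr - s / 2)"
proof (induction M)
  case 0
  then show ?case by simp
next
  case (Suc M)
  have "(P - 1 - (s - 1) / 2 + (s - 1) * (S + p / 2)) + (Q - P + (s - 1) / 2 * (p + q))
          = Q - 1 - (s - 1) / 2 + (s - 1) * (S + p + q / 2)" for P Q S p q :: complex
    by (simp add: algebra_simps add_divide_distrib diff_divide_distrib)
  then show ?case
    unfolding sum.lessThan_Suc Suc.IH unfolding trapezoid_defect_def by blast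
qed

text \<open>
  Up to the factor \<open>s - 1\<close> and constants, the partial sums of the series of defects telescope to
  the trapezoidal sum of \<open>t powr - s\<close> minus the power of \<open>n\<close>. So its difference from the zeta
  value is the tail of that series divided by \<open>s - 1\<close>, up to sign, and the tail is of order \<open>n powr (- s - 1)\<close>.
\<close>
lemma zeta_trapezoid_asymp:
  fixes s :: real
  assumes "-1 < s" "s < 1"
  shows "\<exists>C. \<forall>n\<ge>1. \<bar>(\<Sum>m=1..<n. real m powr - s) + real n powr - s / 2
             - real n powr (1 - s) / (1 - s) - Re (zeta (of_real s))\<bar> \<le> C * real n powr (- s - 1)"
proof -
  define c where "c = trapezoid_bound (of_real s) * (2 powr (s + 2) / (s + 1)) / (1 - s)"
  show ?thesis
  proof (intro exI[of _ c] allI impI)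
    fix n :: nat assume "n \<ge> 1"
    then obtain M where n: "n = Suc M" by (cases n) auto
    define E where "E = (\<Sum>m=1..<n. real m powr - s) + real n powr - s / 2 - real n powr (1 - s) / (1 - s)"
    let ?s = "of_real s :: complex"
    have powr: "of_nat (Suc k) powr of_real r = (of_real (real (Suc k) powr r) :: complex)" for k r
      using powr_of_real[of "real (Suc k)" r] by (simp del: of_nat_Suc)
    have "(\<Sum>m=1..<n. real m powr - s) = (\<Sum>k<M. real (Suc k) powr - s)"
      unfolding n One_nat_def atLeast0LessThan[symmetric] by (rule sum.shift_bounds_Suc_ivl)
    then have E: "of_real E = (\<Sum>k<M. of_nat (Suc k) powr - ?s) + of_nat (Suc M) powr - ?s / 2
         - of_nat (Suc M) powr (1 - ?s) / (1 - ?s)"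
      using powr[of _ "- s"] powr[of _ "1 - s"] by (simp add: E_def n del: of_nat_Suc)
    have "(\<Sum>n. trapezoid_defect n ?s) - (\<Sum>n<M. trapezoid_defect n ?s)
            = (?s - 1) * (zeta ?s - of_real E)"
    proof -
      have "(\<Sum>n. trapezoid_defect n ?s) = (?s - 1) * zeta ?s - 1 - (?s - 1) / 2"
        using zeta_eq_suminf_trapezoid_defect[of ?s] assms by (simp add: algebra_simps)
      moreover have "(?s - 1) * of_real E = of_nat (Suc M) powr (1 - ?s)
          + (?s - 1) * ((\<Sum>k<M. of_nat (Suc k) powr - ?s) + of_nat (Suc M) powr - ?s / 2)"
      proof -
        have "(t - 1) * (A - B / (1 - t)) = B + (t - 1) * A" if "t \<noteq> 1" for t A B :: complex
          using that by (simp add: divide_simps) (simp add: algebra_simps)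
        then show ?thesis unfolding E using assms by simp
      qed
      ultimately show ?thesis
        unfolding sum_trapezoid_defect right_diff_distrib[of "?s - 1"] by simp
    qed
    moreover have "norm ((\<Sum>n. trapezoid_defect n ?s) - (\<Sum>n<M. trapezoid_defect n ?s))
       \<le> trapezoid_bound ?s * (2 powr (- (- s - 2)) / (- (- s - 2) - 1)) * real (Suc M) powr ((- s - 2) + 1)"
      by (rule norm_suminf_diff_partial_le) (use assms norm_trapezoid_defect_le[of ?s] in auto)
    moreover have "norm (?s - 1) = 1 - s"
      using assms norm_of_real[of "s - 1", where ?'a = complex] by simp
    moreover have "- s - 2 + 1 = - s - 1" "- (- s - 2) = s + 2" "- (- s - 2) - 1 = s + 1"
      by simp_all
    ultimately have "(1 - s) * norm (zeta ?s - of_real E)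
        \<le> trapezoid_bound ?s * (2 powr (s + 2) / (s + 1)) * real n powr (- s - 1)"
      by (simp only: norm_mult n)
    moreover have "N \<le> Y / (1 - s) * P" if "(1 - s) * N \<le> Y * P" for N Y P
      using that assms by (simp add: pos_le_divide_eq mult.commute)
    ultimately have "norm (zeta ?s - of_real E) \<le> c * real n powr (- s - 1)"
      unfolding c_def by blast
    moreover have "\<bar>E - Re (zeta ?s)\<bar> \<le> norm (zeta ?s - of_real E)"
      using abs_Re_le_cmod[of "zeta ?s - of_real E"] by simp
    ultimately show "\<bar>(\<Sum>m=1..<n. real m powr - s) + real n powr - s / 2
             - real n powr (1 - s) / (1 - s) - Re (zeta (of_real s))\<bar> \<le> c * real n powr (- s - 1)"
      unfolding E_def by linarith
  qed
qed

section \<open>The trapezoidal rule\<close>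

text \<open>
  Iterating this integration step, which starts from \<open>c\<close>, replaces Taylor's theorem and works with
  one-sided derivatives at the ends of the interval.
\<close>
lemma abs_le_of_deriv_bound:
  fixes f f' :: "real \<Rightarrow> real"
  assumes deriv: "\<And>t. t \<in> {a..b} \<Longrightarrow> (f has_real_derivative f' t) (at t within {a..b})"
    and c: "c \<in> {a..b}" "f c = 0"
    and bound: "\<And>t. t \<in> {a..b} \<Longrightarrow> \<bar>f' t\<bar> \<le> K * \<bar>t - c\<bar> ^ k"
    and t: "t \<in> {a..b}" and K: "K \<ge> 0"
  shows "\<bar>f t\<bar> \<le> K * \<bar>t - c\<bar> ^ Suc k"
proof -
  have sub: "closed_segment c t \<subseteq> {a..b}"
    using c t by (intro closed_segment_subset) auto
  have "norm (f t - f c) \<le> (K * \<bar>t - c\<bar> ^ k) * norm (t - c)"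
  proof (rule field_differentiable_bound[of "closed_segment c t" f f'])
    show "(f has_real_derivative f' z) (at z within closed_segment c t)" if "z \<in> closed_segment c t" for z
      by (rule DERIV_subset[OF deriv sub]) (use that sub in auto)
    show "norm (f' z) \<le> K * \<bar>t - c\<bar> ^ k" if z: "z \<in> closed_segment c t" for z
    proof -
      have "\<bar>z - c\<bar> \<le> \<bar>t - c\<bar>"
        using z by (auto simp: closed_segment_eq_real_ivl split: if_splits)
      then have "K * \<bar>z - c\<bar> ^ k \<le> K * \<bar>t - c\<bar> ^ k"
        using K by (intro mult_left_mono power_mono) auto
      then show ?thesis using bound[of z] z sub by force
    qed
  qed auto
  then show ?thesis using c by (simp add: mult_ac)
qed

text \<open>
  The error, regarded as a function of the right end of the interval, has the derivative \<open>\<psi>\<close>. This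
  vanishes at \<open>a\<close> and has the derivative \<open>(t - a) q''(t) / 2\<close>, so two integrations from \<open>a\<close> give the
  bound.
\<close>
lemma trapezoid_error:
  fixes q q' q'' :: "real \<Rightarrow> real"
  assumes ab: "a \<le> b"
    and q: "\<And>t. t \<in> {a..b} \<Longrightarrow> (q has_real_derivative q' t) (at t within {a..b})"
    and q': "\<And>t. t \<in> {a..b} \<Longrightarrow> (q' has_real_derivative q'' t) (at t within {a..b})"
    and bound: "\<And>t. t \<in> {a..b} \<Longrightarrow> \<bar>q'' t\<bar> \<le> K"
  shows "\<bar>integral {a..b} q - (b - a) * (q a + q b) / 2\<bar> \<le> K * (b - a) ^ 3"
proof -
  have K: "K \<ge> 0" using bound[of a] ab by force
  have cont: "continuous_on {a..b} q"
    using q by (meson DERIV_continuous_on)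
  define \<psi> where "\<psi> t = (q a - q t) / 2 + (t - a) * q' t / 2" for t
  define \<phi> where "\<phi> t = (t - a) * (q a + q t) / 2 - integral {a..t} q" for t
  have \<psi>_deriv: "(\<psi> has_real_derivative (t - a) * q'' t / 2) (at t within {a..b})" if "t \<in> {a..b}" for t
    unfolding \<psi>_def using q[OF that] q'[OF that]
    by (auto intro!: derivative_eq_intros simp: field_simps)
  have \<psi>_le: "\<bar>\<psi> t\<bar> \<le> K / 2 * \<bar>t - a\<bar> ^ Suc 1" if "t \<in> {a..b}" for t
  proof (rule abs_le_of_deriv_bound[OF \<psi>_deriv])
    show "\<bar>(t - a) * q'' t / 2\<bar> \<le> K / 2 * \<bar>t - a\<bar> ^ 1" if "t \<in> {a..b}" for t
      using mult_right_mono[OF bound[OF that], of "\<bar>t - a\<bar>"] by (simp add: abs_mult mult.commute)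
  qed (use that ab K in \<open>auto simp: \<psi>_def\<close>)
  have \<phi>_deriv: "(\<phi> has_real_derivative \<psi> t) (at t within {a..b})" if "t \<in> {a..b}" for t
    unfolding \<phi>_def \<psi>_def using q[OF that] integral_has_real_derivative[OF cont that]
    by (auto intro!: derivative_eq_intros simp: field_simps)
  have "\<bar>\<phi> b\<bar> \<le> K / 2 * \<bar>b - a\<bar> ^ Suc (Suc 1)"
    by (rule abs_le_of_deriv_bound[OF \<phi>_deriv _ _ \<psi>_le]) (use ab K in \<open>auto simp: \<phi>_def\<close>)
  also have "\<dots> \<le> K * (b - a) ^ 3"
    using ab K by (simp add: eval_nat_numeral)
  finally show ?thesis by (simp add: \<phi>_def abs_minus_commute)
qed

lemma sum_powr_le:
  fixes \<alpha> :: real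
  assumes "0 < \<alpha>" "\<alpha> < 1"
  shows "(\<Sum>m=1..n. real m powr - \<alpha>) \<le> real n powr (1 - \<alpha>) / (1 - \<alpha>)"
proof (induction n)
  case 0
  then show ?case by simp
next
  case (Suc n)
  have "real (Suc n) powr - \<alpha> \<le> (real (Suc n) powr (1 - \<alpha>) - real n powr (1 - \<alpha>)) / (1 - \<alpha>)"
  proof (cases "n = 0")
    case True
    then show ?thesis using assms by simp
  next
    case False
    have "\<exists>\<xi>. real n < \<xi> \<and> \<xi> < real (Suc n) \<and> real (Suc n) powr (1 - \<alpha>) - real n powr (1 - \<alpha>)
             = (real (Suc n) - real n) * ((1 - \<alpha>) * \<xi> powr (1 - \<alpha> - 1))"
      by (rule MVT2) (use False in \<open>auto intro!: derivative_eq_intros\<close>)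
    then obtain \<xi> where \<xi>: "real n < \<xi>" "\<xi> < real (Suc n)"
        "real (Suc n) powr (1 - \<alpha>) - real n powr (1 - \<alpha>) = (1 - \<alpha>) * \<xi> powr - \<alpha>"
      by auto
    have "real (Suc n) powr - \<alpha> \<le> \<xi> powr - \<alpha>"
      using \<xi> assms by (intro powr_mono2') auto
    then show ?thesis using \<xi>(3) assms by simp
  qed
  then show ?case using Suc.IH by (simp add: diff_divide_distrib)
qed

text \<open>
  The integrand \<open>t powr - \<alpha> * g t\<close> with \<open>g\<close> twice differentiable up to the ends of the interval.
  Its regular part \<open>q\<close> is obtained by replacing \<open>g\<close> by the remainder \<open>r\<close> of its linear Taylor
  polynomial at the singularity.
\<close>
locale singular_integrand =
  fixes \<alpha> x B :: real and g g' g'' :: "real \<Rightarrow> real"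
  assumes \<alpha>: "0 < \<alpha>" "\<alpha> < 1" and x: "0 < x"
    and g: "\<And>t. t \<in> {0..x} \<Longrightarrow> (g has_real_derivative g' t) (at t within {0..x})"
    and g': "\<And>t. t \<in> {0..x} \<Longrightarrow> (g' has_real_derivative g'' t) (at t within {0..x})"
    and g''_le: "\<And>t. t \<in> {0..x} \<Longrightarrow> \<bar>g'' t\<bar> \<le> B"
begin

definition r where "r t = g t - g 0 - g' 0 * t"
definition r' where "r' t = g' t - g' 0"
definition q where "q t = t powr - \<alpha> * r t"

lemma B_nonneg: "B \<ge> 0"
  using g''_le[of 0] x by force

lemma r_deriv: "t \<in> {0..x} \<Longrightarrow> (r has_real_derivative r' t) (at t within {0..x})"
  unfolding r_def r'_def using g by (auto intro!: derivative_eq_intros)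

lemma r'_deriv: "t \<in> {0..x} \<Longrightarrow> (r' has_real_derivative g'' t) (at t within {0..x})"
  unfolding r'_def using g' by (auto intro!: derivative_eq_intros)

lemma r'_le: "t \<in> {0..x} \<Longrightarrow> \<bar>r' t\<bar> \<le> B * t"
  using abs_le_of_deriv_bound[OF r'_deriv, of 0 B 0 t] g''_le B_nonneg x by (auto simp: r'_def)

lemma r_le: "t \<in> {0..x} \<Longrightarrow> \<bar>r t\<bar> \<le> B * t ^ 2"
  using abs_le_of_deriv_bound[OF r_deriv, of 0 B 1 t] r'_le B_nonneg x
  by (auto simp: r_def power2_eq_square)

lemma q_le:
  assumes "t \<in> {0..x}"
  shows "\<bar>q t\<bar> \<le> B * t powr (2 - \<alpha>)"
proof (cases "t = 0")
  case False
  have "\<bar>q t\<bar> \<le> t powr - \<alpha> * (B * t ^ 2)"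
    unfolding q_def abs_mult using r_le[OF assms] by (intro mult_mono) auto
  also have "\<dots> = B * (t powr - \<alpha> * t powr 2)"
    using False assms by simp
  also have "t powr - \<alpha> * t powr 2 = t powr (2 - \<alpha>)"
    unfolding powr_add[symmetric] by simp
  finally show ?thesis .
qed (simp add: q_def)

lemma continuous_on_q: "continuous_on {0..x} q"
  unfolding continuous_on_eq_continuous_within
proof
  fix t assume t: "t \<in> {0..x}"
  show "continuous (at t within {0..x}) q"
  proof (cases "t = 0")
    case True
    have "((\<lambda>t. B * t powr (2 - \<alpha>)) \<longlongrightarrow> 0) (at 0 within {0..x})"
    proof -
      have "((\<lambda>t. t powr (2 - \<alpha>)) \<longlongrightarrow> 0 powr (2 - \<alpha>)) (at 0 within {0..x})"
        by (rule tendsto_powr') (use \<alpha> in \<open>auto simp: eventually_at_filter\<close>)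
      from tendsto_mult_left[OF this, of B] show ?thesis by simp
    qed
    then have "(q \<longlongrightarrow> 0) (at 0 within {0..x})"
    proof (rule Lim_null_comparison[rotated])
      show "\<forall>\<^sub>F t in at 0 within {0..x}. norm (q t) \<le> B * t powr (2 - \<alpha>)"
        using q_le by (auto simp: eventually_at_filter)
    qed
    then show ?thesis by (simp add: True continuous_within q_def)
  next
    case False
    have "continuous (at t within {0..x}) r"
      using r_deriv[OF t] by (rule DERIV_continuous)
    then show ?thesis
      unfolding q_def using False t by (intro continuous_intros) auto
  qed
qed

text \<open>
  Where \<open>t > 0\<close>, these are the first two derivatives of \<open>q\<close>.
\<close>
definition q' where "q' t = - \<alpha> * t powr (- \<alpha> - 1) * r t + t powr - \<alpha> * r' t"
definition q'' where "q'' t = - \<alpha> * (- \<alpha> - 1) * t powr (- \<alpha> - 2) * r t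
    + 2 * (- \<alpha> * t powr (- \<alpha> - 1) * r' t) + t powr - \<alpha> * g'' t"

lemma q_deriv: "t \<in> {0<..x} \<Longrightarrow> (q has_real_derivative q' t) (at t within {0..x})"
  unfolding q_def q'_def using r_deriv[of t]
  by (auto intro!: derivative_eq_intros)

lemma q'_deriv: "t \<in> {0<..x} \<Longrightarrow> (q' has_real_derivative q'' t) (at t within {0..x})"
  unfolding q'_def q''_def using r_deriv[of t] r'_deriv[of t]
  by (auto intro!: derivative_eq_intros simp: algebra_simps)

text \<open>
  Since \<open>r\<close> and its derivative are of order \<open>t^2\<close> and \<open>t\<close>, each of the three terms of
  \<open>q''\<close> is of order \<open>t powr - \<alpha>\<close>. The constants are \<open>\<alpha> (\<alpha> + 1) + 2 \<alpha> + 1 \<le> 5\<close>.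
\<close>
lemma q''_le:
  assumes t: "t \<in> {0<..x}"
  shows "\<bar>q'' t\<bar> \<le> 5 * B * t powr - \<alpha>"
proof -
  have t0: "t > 0" "t \<in> {0..x}" using t by auto
  define P where "P = t powr - \<alpha>"
  have P: "t powr (- \<alpha> - 2) = P / t ^ 2" "t powr (- \<alpha> - 1) = P / t" "P > 0"
    using t0 powr_diff[of t "- \<alpha>" 2] powr_diff[of t "- \<alpha>" 1] by (auto simp: P_def)
  have "\<bar>\<alpha> * (\<alpha> + 1) * (P / t ^ 2) * r t\<bar> \<le> 2 * (P / t ^ 2) * (B * t ^ 2)"
  proof -
    have "\<alpha> * (\<alpha> + 1) \<le> 1 * 2" using \<alpha> by (intro mult_mono) auto
    then show ?thesis
      unfolding abs_mult using r_le[OF t0(2)] \<alpha> P(3) t0 by (intro mult_mono) auto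
  qed
  moreover have "\<bar>2 * \<alpha> * (P / t) * r' t\<bar> \<le> 2 * (P / t) * (B * t)"
    unfolding abs_mult using r'_le[OF t0(2)] \<alpha> P(3) t0 by (intro mult_mono) auto
  moreover have "\<bar>P * g'' t\<bar> \<le> P * B"
    unfolding abs_mult using g''_le[OF t0(2)] P(3) by simp
  moreover have "q'' t = \<alpha> * (\<alpha> + 1) * (P / t ^ 2) * r t - 2 * \<alpha> * (P / t) * r' t + P * g'' t"
    unfolding q''_def P(1,2) P_def[symmetric] by (simp add: algebra_simps)
  moreover have "\<bar>a - b + c\<bar> \<le> A + B' + C"
    if "\<bar>a\<bar> \<le> A" "\<bar>b\<bar> \<le> B'" "\<bar>c\<bar> \<le> C" for a b c A B' C :: real
    using that by linarith
  ultimately have "\<bar>q'' t\<bar> \<le> 2 * (P / t ^ 2) * (B * t ^ 2) + 2 * (P / t) * (B * t) + P * B"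
    by presburger
  also have "\<dots> = 5 * B * P" using t0 by (simp add: power2_eq_square)
  finally show ?thesis by (simp add: P_def)
qed

text \<open>
  On the cell next to the singularity \<open>q\<close> itself is so small that both the integral and the
  trapezoid are within the error bound; on the other cells the second derivative is bounded by its
  bound at the left end of the cell.
\<close>
lemma q_trapezoid_le:
  assumes h: "h > 0" and N: "1 \<le> N" "real N * h \<le> x"
  shows "\<bar>integral {0..real N * h} q - (h * (\<Sum>m=1..<N. q (real m * h)) + h * q (real N * h) / 2)\<bar>
           \<le> 2 * B * h powr (3 - \<alpha>) + 5 * B * h ^ 3 * (\<Sum>m=1..<N. (real m * h) powr - \<alpha>)"
  using N
proof (induction N rule: dec_induct)
  case base
  have sub: "{0..h} \<subseteq> {0..x}" using base by auto
  have "norm (integral {0..h} q) \<le> (B * h powr (2 - \<alpha>)) * (h - 0)"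
  proof (rule integral_bound)
    show "continuous_on {0..h} q" using continuous_on_q sub by (rule continuous_on_subset)
    show "norm (q t) \<le> B * h powr (2 - \<alpha>)" if "t \<in> {0..h}" for t
    proof -
      have "\<bar>q t\<bar> \<le> B * t powr (2 - \<alpha>)" using that sub by (intro q_le) auto
      also have "\<dots> \<le> B * h powr (2 - \<alpha>)"
        using that B_nonneg \<alpha> by (intro mult_left_mono powr_mono2) auto
      finally show ?thesis by simp
    qed
  qed (use h in auto)
  moreover have "\<bar>h * q h / 2\<bar> \<le> h * (B * h powr (2 - \<alpha>))"
  proof -
    have "h * \<bar>q h\<bar> \<le> h * (B * h powr (2 - \<alpha>))"
      using h q_le[of h] base by (intro mult_left_mono) auto
    moreover have "h * \<bar>q h\<bar> \<ge> 0" using h by simp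
    ultimately show ?thesis using h by (simp add: abs_mult)
  qed
  moreover have "h * h powr (2 - \<alpha>) = h powr (3 - \<alpha>)"
    using h powr_add[of h 1 "2 - \<alpha>"] by simp
  ultimately show ?case by (simp add: algebra_simps) 
next
  case (step N)
  define u v where "u = real N * h" and "v = real (Suc N) * h"
  have uv: "0 < u" "u \<le> v" "v \<le> x" "v - u = h"
    using step.hyps step.prems h by (auto simp: u_def v_def algebra_simps)
  have sub: "{u..v} \<subseteq> {0..x}" "{u..v} \<subseteq> {0<..x}" using uv by auto
  have cell: "\<bar>integral {u..v} q - (v - u) * (q u + q v) / 2\<bar> \<le> (5 * B * u powr - \<alpha>) * (v - u) ^ 3"
  proof (rule trapezoid_error)
    show "(q has_real_derivative q' t) (at t within {u..v})"
         "(q' has_real_derivative q'' t) (at t within {u..v})" if "t \<in> {u..v}" for t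
      using that sub by (blast intro: DERIV_subset[OF q_deriv] DERIV_subset[OF q'_deriv])+
    show "\<bar>q'' t\<bar> \<le> 5 * B * u powr - \<alpha>" if "t \<in> {u..v}" for t
    proof -
      have "\<bar>q'' t\<bar> \<le> 5 * B * t powr - \<alpha>" using that sub by (intro q''_le) auto
      also have "\<dots> \<le> 5 * B * u powr - \<alpha>"
        using that uv B_nonneg \<alpha> by (intro mult_left_mono powr_mono2') auto
      finally show ?thesis .
    qed
  qed (use uv in auto)
  have "q integrable_on {0..v}"
    using uv by (intro integrable_continuous_interval continuous_on_subset[OF continuous_on_q]) auto
  then have "integral {0..v} q = integral {0..u} q + integral {u..v} q"
    using uv by (intro Henstock_Kurzweil_Integration.integral_combine[symmetric]) auto
  moreover have "\<bar>integral {0..u} q - (h * (\<Sum>m=1..<N. q (real m * h)) + h * q u / 2)\<bar>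
           \<le> 2 * B * h powr (3 - \<alpha>) + 5 * B * h ^ 3 * (\<Sum>m=1..<N. (real m * h) powr - \<alpha>)"
    using step.IH uv by (simp add: u_def)
  moreover have "h * (\<Sum>m=1..<Suc N. q (real m * h)) = h * (\<Sum>m=1..<N. q (real m * h)) + h * q u"
    using step.hyps by (simp add: u_def algebra_simps)
  moreover have "5 * B * h ^ 3 * (\<Sum>m=1..<Suc N. (real m * h) powr - \<alpha>)
      = 5 * B * h ^ 3 * (\<Sum>m=1..<N. (real m * h) powr - \<alpha>) + (5 * B * u powr - \<alpha>) * h ^ 3"
    using step.hyps by (simp add: u_def algebra_simps)
  moreover have "h * (q u + q v) / 2 = h * q u / 2 + h * q v / 2"
    by (simp add: algebra_simps)
  ultimately show ?case
    using cell unfolding uv(4) v_def[symmetric] by linarith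
qed


end

lemma riemann_sum_powr_le:
  fixes \<alpha> :: real
  assumes "0 < \<alpha>" "\<alpha> < 1" "h > 0"
  shows "h * (\<Sum>m=1..<n. (real m * h) powr - \<alpha>) \<le> (real n * h) powr (1 - \<alpha>) / (1 - \<alpha>)"
proof -
  have "h * (\<Sum>m=1..<n. (real m * h) powr - \<alpha>) = h powr (1 - \<alpha>) * (\<Sum>m=1..<n. real m powr - \<alpha>)"
  proof -
    have "h * h powr - \<alpha> = h powr (1 - \<alpha>)"
      using assms powr_add[of h 1 "- \<alpha>"] by simp
    moreover have "(\<Sum>m=1..<n. (real m * h) powr - \<alpha>) = h powr - \<alpha> * (\<Sum>m=1..<n. real m powr - \<alpha>)"
      using assms by (simp add: powr_mult sum_distrib_left mult.commute)
    ultimately show ?thesis by (simp add: mult.assoc[symmetric])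
  qed
  also have "\<dots> \<le> h powr (1 - \<alpha>) * (\<Sum>m=1..n. real m powr - \<alpha>)"
    by (intro mult_left_mono sum_mono2) auto
  also have "\<dots> \<le> h powr (1 - \<alpha>) * (real n powr (1 - \<alpha>) / (1 - \<alpha>))"
    using assms by (intro mult_left_mono sum_powr_le) auto
  also have "\<dots> = (real n * h) powr (1 - \<alpha>) / (1 - \<alpha>)"
    using assms by (simp add: powr_mult)
  finally show ?thesis .
qed

text \<open>
  The trapezoidal sum for \<open>n\<close> cells on \<open>{0..x}\<close> without the node \<open>0\<close>, where the integrands of
  interest are singular.
\<close>
definition punctured_trapezoid :: "(real \<Rightarrow> real) \<Rightarrow> real \<Rightarrow> nat \<Rightarrow> real" where
  "punctured_trapezoid f x n = x / real n * ((\<Sum>m=1..<n. f (real m * (x / real n))) + f x / 2)"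

lemma punctured_trapezoid_add:
  "punctured_trapezoid (\<lambda>t. f t + g t) x n = punctured_trapezoid f x n + punctured_trapezoid g x n"
  by (simp add: punctured_trapezoid_def sum.distrib algebra_simps add_divide_distrib)

lemma punctured_trapezoid_cmult:
  "punctured_trapezoid (\<lambda>t. c * f t) x n = c * punctured_trapezoid f x n"
  by (simp add: punctured_trapezoid_def sum_distrib_left[symmetric] algebra_simps)

text \<open>
  With \<open>x = n h\<close> the sum is \<open>h powr (1 - s)\<close> times the one in \<open>zeta_trapezoid_asymp\<close>, and
  the error term there becomes \<open>h powr (1 - s) * n powr (- s - 1) = x powr (- s - 1) * h^2\<close>.
\<close>
lemma punctured_trapezoid_powr:
  fixes s x :: real
  assumes s: "-1 < s" "s < 1" and x: "x > 0"
  shows "\<exists>C. \<forall>n\<ge>1. let h = x / real n in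
           \<bar>punctured_trapezoid (\<lambda>t. t powr - s) x n
             - (x powr (1 - s) / (1 - s) + Re (zeta (of_real s)) * h powr (1 - s))\<bar> \<le> C * h ^ 2"
proof -
  obtain C where C: "\<And>n. n \<ge> 1 \<Longrightarrow> \<bar>(\<Sum>m=1..<n. real m powr - s) + real n powr - s / 2
             - real n powr (1 - s) / (1 - s) - Re (zeta (of_real s))\<bar> \<le> C * real n powr (- s - 1)"
    using zeta_trapezoid_asymp[OF s] by blast
  have "let h = x / real n in
           \<bar>punctured_trapezoid (\<lambda>t. t powr - s) x n
             - (x powr (1 - s) / (1 - s) + Re (zeta (of_real s)) * h powr (1 - s))\<bar>
           \<le> (C * x powr (- s - 1)) * h ^ 2" if n: "n \<ge> 1" for n
  proof -
    define h where "h = x / real n"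
    have h: "h > 0" "x = real n * h" using x n by (auto simp: h_def)
    define S where "S = (\<Sum>m=1..<n. real m powr - s)"
    have hp: "h powr (1 - s) = h * h powr - s"
      using h powr_add[of h 1 "- s"] by simp
    have "punctured_trapezoid (\<lambda>t. t powr - s) x n
            = h * ((\<Sum>m=1..<n. (real m * h) powr - s) + (real n * h) powr - s / 2)"
      unfolding punctured_trapezoid_def h_def[symmetric] using h(2) by simp
    also have "\<dots> = h powr (1 - s) * (S + real n powr - s / 2)"
      using h by (simp add: hp S_def powr_mult sum_distrib_left algebra_simps)
    finally have T: "punctured_trapezoid (\<lambda>t. t powr - s) x n = h powr (1 - s) * (S + real n powr - s / 2)" .
    have "x powr (1 - s) / (1 - s) = h powr (1 - s) * (real n powr (1 - s) / (1 - s))"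
      using h by (simp add: powr_mult)
    then have "punctured_trapezoid (\<lambda>t. t powr - s) x n
             - (x powr (1 - s) / (1 - s) + Re (zeta (of_real s)) * h powr (1 - s))
          = h powr (1 - s) * (S + real n powr - s / 2 - real n powr (1 - s) / (1 - s) - Re (zeta (of_real s)))"
      unfolding T by (simp only: algebra_simps)
    then have "\<bar>punctured_trapezoid (\<lambda>t. t powr - s) x n
             - (x powr (1 - s) / (1 - s) + Re (zeta (of_real s)) * h powr (1 - s))\<bar>
          \<le> h powr (1 - s) * (C * real n powr (- s - 1))"
      using C[OF n] unfolding S_def[symmetric] by (simp add: abs_mult mult_left_mono)
    also have "\<dots> = (C * x powr (- s - 1)) * h ^ 2"
    proof -
      have "h powr (1 - s) = h powr (- s - 1) * h powr 2"
        unfolding powr_add[symmetric] by simp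
      then show ?thesis using h by (simp add: powr_mult)
    qed
    finally show ?thesis unfolding h_def by (simp add: Let_def)
  qed
  then show ?thesis by blast
qed

context singular_integrand
begin

lemma punctured_trapezoid_q:
  "\<exists>C. \<forall>n\<ge>1. let h = x / real n in \<bar>punctured_trapezoid q x n - integral {0..x} q\<bar> \<le> C * h ^ 2"
proof -
  define C where "C = 2 * B * x powr (1 - \<alpha>) + 5 * B * (x powr (1 - \<alpha>) / (1 - \<alpha>))"
  have "let h = x / real n in \<bar>punctured_trapezoid q x n - integral {0..x} q\<bar> \<le> C * h ^ 2"
    if n: "n \<ge> 1" for n
  proof -
    define h where "h = x / real n"
    have h: "h > 0" "real n * h = x" "h \<le> x" using x n by (auto simp: h_def field_simps)
    define S where "S = (\<Sum>m=1..<n. (real m * h) powr - \<alpha>)"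
    have "h powr (3 - \<alpha>) = h ^ 2 * h powr (1 - \<alpha>)"
      using h powr_add[of h 2 "1 - \<alpha>"] by simp
    also have "\<dots> \<le> h ^ 2 * x powr (1 - \<alpha>)"
      using h \<alpha> by (intro mult_left_mono powr_mono2) auto
    finally have first: "2 * B * h powr (3 - \<alpha>) \<le> 2 * B * (h ^ 2 * x powr (1 - \<alpha>))"
      using B_nonneg by (intro mult_left_mono) auto
    have "h * S \<le> x powr (1 - \<alpha>) / (1 - \<alpha>)"
      using riemann_sum_powr_le[OF \<alpha> h(1), of n] by (simp add: S_def h)
    then have rest: "5 * B * h ^ 2 * (h * S) \<le> 5 * B * h ^ 2 * (x powr (1 - \<alpha>) / (1 - \<alpha>))"
      using B_nonneg by (intro mult_left_mono) auto
    have "\<bar>integral {0..real n * h} q - (h * (\<Sum>m=1..<n. q (real m * h)) + h * q (real n * h) / 2)\<bar>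
           \<le> 2 * B * h powr (3 - \<alpha>) + 5 * B * h ^ 3 * S"
      unfolding S_def by (rule q_trapezoid_le) (use h n in auto)
    also have "5 * B * h ^ 3 * S = 5 * B * h ^ 2 * (h * S)"
      by (simp add: eval_nat_numeral)
    also have "h * (\<Sum>m=1..<n. q (real m * h)) + h * q (real n * h) / 2 = punctured_trapezoid q x n"
      unfolding punctured_trapezoid_def h_def[symmetric] h(2) by (simp add: algebra_simps)
    finally have "\<bar>punctured_trapezoid q x n - integral {0..x} q\<bar>
        \<le> 2 * B * (h ^ 2 * x powr (1 - \<alpha>)) + 5 * B * h ^ 2 * (x powr (1 - \<alpha>) / (1 - \<alpha>))"
      using first rest unfolding h(2) by linarith
    also have "\<dots> = C * h ^ 2"
      by (simp add: C_def algebra_simps)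
    finally show ?thesis by (simp add: Let_def h_def)
  qed
  then show ?thesis by blast
qed

text \<open>
  Write \<open>t powr - \<alpha> * g t = g 0 * t powr - \<alpha> + g' 0 * t powr - (\<alpha> - 1) + q t\<close>. The sum and the
  integral are linear, the powers contribute the zeta values, and for \<open>q\<close> the sum agrees with
  the integral up to \<open>O(h^2)\<close>.
\<close>
theorem singular_euler_maclaurin:
  "\<exists>C. \<forall>n\<ge>1. let h = x / real n in
     \<bar>punctured_trapezoid (\<lambda>t. t powr - \<alpha> * g t) x n
       - (integral {0..x} (\<lambda>t. t powr - \<alpha> * g t)
          + Re (zeta (of_real \<alpha>)) * g 0 * h powr (1 - \<alpha>)
          + Re (zeta (of_real (\<alpha> - 1))) * g' 0 * h powr (2 - \<alpha>))\<bar> \<le> C * h ^ 2"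
proof -
  define T where "T f = punctured_trapezoid f x" for f
  define I where "I s = x powr (1 - s) / (1 - s)" for s
  define z where "z s = Re (zeta (of_real s))" for s
  \<comment> \<open>At \<open>t = 0\<close> all four terms are \<open>0\<close>, because \<open>0 powr a = 0\<close>.\<close>
  have split: "t powr - \<alpha> * g t = (g 0 * t powr - \<alpha> + g' 0 * t powr - (\<alpha> - 1)) + q t" if "t \<ge> 0" for t
  proof (cases "t = 0")
    case False
    then have "t powr - (\<alpha> - 1) = t powr - \<alpha> * t"
      using that powr_add[of t "- \<alpha>" 1] by simp
    then show ?thesis by (simp add: q_def r_def algebra_simps)
  qed (simp add: q_def)
  have T: "T (\<lambda>t. t powr - \<alpha> * g t) n
      = g 0 * T (\<lambda>t. t powr - \<alpha>) n + g' 0 * T (\<lambda>t. t powr - (\<alpha> - 1)) n + T q n" for n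
  proof -
    have "T (\<lambda>t. t powr - \<alpha> * g t) n
        = T (\<lambda>t. (g 0 * t powr - \<alpha> + g' 0 * t powr - (\<alpha> - 1)) + q t) n"
      unfolding T_def punctured_trapezoid_def using x
      by (intro arg_cong2[where f = "(*)"] arg_cong2[where f = "(+)"] arg_cong2[where f = "(/)"] sum.cong split) auto
    then show ?thesis
      by (simp only: T_def punctured_trapezoid_add punctured_trapezoid_cmult)
  qed
  have int_powr: "((\<lambda>t. t powr - s) has_integral I s) {0..x}" if "s < 1" for s
    using has_integral_powr_from_0[of "- s" x] that x by (simp add: I_def add.commute)
  have "((\<lambda>t. (g 0 * t powr - \<alpha> + g' 0 * t powr - (\<alpha> - 1)) + q t) has_integral
          ((g 0 * I \<alpha> + g' 0 * I (\<alpha> - 1)) + integral {0..x} q)) {0..x}"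
    using \<alpha> integrable_continuous_interval[OF continuous_on_q]
    by (intro has_integral_add has_integral_mult_right int_powr integrable_integral) auto
  then have "((\<lambda>t. t powr - \<alpha> * g t) has_integral
          ((g 0 * I \<alpha> + g' 0 * I (\<alpha> - 1)) + integral {0..x} q)) {0..x}"
    by (rule has_integral_eq[rotated]) (use split in auto)
  then have int: "integral {0..x} (\<lambda>t. t powr - \<alpha> * g t)
      = g 0 * I \<alpha> + g' 0 * I (\<alpha> - 1) + integral {0..x} q"
    by (rule integral_unique)
  obtain C0 where C0: "\<And>n. n \<ge> 1 \<Longrightarrow>
      \<bar>T (\<lambda>t. t powr - \<alpha>) n - (I \<alpha> + z \<alpha> * (x / real n) powr (1 - \<alpha>))\<bar> \<le> C0 * (x / real n) ^ 2"
    using punctured_trapezoid_powr[of \<alpha> x] \<alpha> x unfolding Let_def T_def I_def z_def by auto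
  obtain C1 where C1: "\<And>n. n \<ge> 1 \<Longrightarrow>
      \<bar>T (\<lambda>t. t powr - (\<alpha> - 1)) n - (I (\<alpha> - 1) + z (\<alpha> - 1) * (x / real n) powr (1 - (\<alpha> - 1)))\<bar>
        \<le> C1 * (x / real n) ^ 2"
    using punctured_trapezoid_powr[of "\<alpha> - 1" x] \<alpha> x unfolding Let_def T_def I_def z_def by auto
  obtain C2 where C2: "\<And>n. n \<ge> 1 \<Longrightarrow> \<bar>T q n - integral {0..x} q\<bar> \<le> C2 * (x / real n) ^ 2"
    using punctured_trapezoid_q unfolding Let_def T_def by auto
  have "\<bar>T (\<lambda>t. t powr - \<alpha> * g t) n
       - (integral {0..x} (\<lambda>t. t powr - \<alpha> * g t) + z \<alpha> * g 0 * h powr (1 - \<alpha>)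
          + z (\<alpha> - 1) * g' 0 * h powr (2 - \<alpha>))\<bar> \<le> (\<bar>g 0\<bar> * C0 + \<bar>g' 0\<bar> * C1 + C2) * h ^ 2"
    if n: "n \<ge> 1" and h: "h = x / real n" for n h
  proof -
    define e0 where "e0 = T (\<lambda>t. t powr - \<alpha>) n - (I \<alpha> + z \<alpha> * h powr (1 - \<alpha>))"
    define e1 where "e1 = T (\<lambda>t. t powr - (\<alpha> - 1)) n - (I (\<alpha> - 1) + z (\<alpha> - 1) * h powr (2 - \<alpha>))"
    define e2 where "e2 = T q n - integral {0..x} q"
    have "T (\<lambda>t. t powr - \<alpha> * g t) n
       - (integral {0..x} (\<lambda>t. t powr - \<alpha> * g t) + z \<alpha> * g 0 * h powr (1 - \<alpha>)
          + z (\<alpha> - 1) * g' 0 * h powr (2 - \<alpha>)) = g 0 * e0 + g' 0 * e1 + e2"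
      unfolding T int e0_def e1_def e2_def by (simp only: algebra_simps)
    also have "\<bar>\<dots>\<bar> \<le> \<bar>g 0\<bar> * \<bar>e0\<bar> + \<bar>g' 0\<bar> * \<bar>e1\<bar> + \<bar>e2\<bar>"
      unfolding abs_mult[symmetric] by linarith
    also have "\<dots> \<le> \<bar>g 0\<bar> * (C0 * h ^ 2) + \<bar>g' 0\<bar> * (C1 * h ^ 2) + C2 * h ^ 2"
      using C0[OF n] C1[OF n] C2[OF n] unfolding h[symmetric]
      by (intro add_mono mult_left_mono) (auto simp: e0_def e1_def e2_def)
    finally show ?thesis by (simp add: algebra_simps)
  qed
  then show ?thesis unfolding Let_def T_def z_def by blast
qed

end

section \<open>From the weighted sum to the Caputo derivative\<close>

text \<open>
  Subtracting the quadratic Taylor polynomial at \<open>c\<close> leaves the central difference minus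
  \<open>2 h f'(c)\<close>, since the terms of even order cancel; each of the two remaining values is at most
  \<open>B h^3\<close>.
\<close>
lemma central_difference_error:
  fixes f :: "nat \<Rightarrow> real \<Rightarrow> real"
  assumes deriv: "\<And>k t. t \<in> {a..b} \<Longrightarrow> (f k has_real_derivative f (Suc k) t) (at t within {a..b})"
    and bound: "\<And>t. t \<in> {a..b} \<Longrightarrow> \<bar>f 3 t\<bar> \<le> B"
    and c: "c - h \<in> {a..b}" "c + h \<in> {a..b}" and h: "h \<ge> 0"
  shows "\<bar>f 0 (c + h) - f 0 (c - h) - 2 * h * f 1 c\<bar> \<le> 2 * B * h ^ 3"
proof -
  have c_in: "c \<in> {a..b}" using c h by auto
  have B: "B \<ge> 0" using bound[OF c_in] by linarith
  define p where "p t = f 0 t - f 0 c - f 1 c * (t - c) - f 2 c * (t - c) ^ 2 / 2" for t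
  define p' where "p' t = f 1 t - f 1 c - f 2 c * (t - c)" for t
  define p'' where "p'' t = f 2 t - f 2 c" for t
  have deriv012: "(f 0 has_real_derivative f 1 t) (at t within {a..b})"
      "(f 1 has_real_derivative f 2 t) (at t within {a..b})"
      "(f 2 has_real_derivative f 3 t) (at t within {a..b})" if "t \<in> {a..b}" for t
    using deriv[OF that, of 0] deriv[OF that, of 1] deriv[OF that, of 2] by (simp_all add: eval_nat_numeral)
  have p'': "(p'' has_real_derivative f 3 t) (at t within {a..b})" if "t \<in> {a..b}" for t
    unfolding p''_def using deriv012[OF that] by (auto intro!: derivative_eq_intros)
  have p': "(p' has_real_derivative p'' t) (at t within {a..b})" if "t \<in> {a..b}" for t
    unfolding p'_def p''_def using deriv012[OF that] by (auto intro!: derivative_eq_intros)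
  have p: "(p has_real_derivative p' t) (at t within {a..b})" if "t \<in> {a..b}" for t
    unfolding p_def p'_def using deriv012[OF that] by (auto intro!: derivative_eq_intros)
  have "\<bar>p'' t\<bar> \<le> B * \<bar>t - c\<bar> ^ Suc 0" if "t \<in> {a..b}" for t
    by (rule abs_le_of_deriv_bound[OF p'' c_in]) (use that bound B in \<open>auto simp: p''_def\<close>)
  then have "\<bar>p' t\<bar> \<le> B * \<bar>t - c\<bar> ^ Suc (Suc 0)" if "t \<in> {a..b}" for t
    by (intro abs_le_of_deriv_bound[OF p' c_in]) (use that B in \<open>auto simp: p'_def\<close>)
  then have p_le: "\<bar>p t\<bar> \<le> B * \<bar>t - c\<bar> ^ Suc (Suc (Suc 0))" if "t \<in> {a..b}" for t
    by (intro abs_le_of_deriv_bound[OF p c_in]) (use that B in \<open>auto simp: p_def\<close>)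
  have "f 0 (c + h) - f 0 (c - h) - 2 * h * f 1 c = p (c + h) - p (c - h)"
    by (simp add: p_def)
  moreover have "\<bar>p (c + h)\<bar> \<le> B * h ^ 3" "\<bar>p (c - h)\<bar> \<le> B * h ^ 3"
    using p_le[OF c(1)] p_le[OF c(2)] h by (simp_all add: eval_nat_numeral)
  ultimately show ?thesis by linarith
qed

text \<open>
  Each weight is a difference of two parts: \<open>(k + 1) powr - \<alpha>\<close>, present for \<open>k \<le> n - 2\<close>, and
  \<open>(k - 1) powr - \<alpha>\<close>, present for \<open>k \<ge> 2\<close>. The irregular weights at both ends are those where one part
  is missing. Both parts are summed over \<open>m = k + 1\<close> and \<open>m = k - 1\<close>, respectively.
\<close>
lemma sum_omega_eq:
  fixes Y :: "nat \<Rightarrow> real"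
  assumes n: "n \<ge> 4"
  shows "(\<Sum>k=0..n. omega \<alpha> n k * Y (n - k))
           = (\<Sum>m=1..<n. real m powr - \<alpha> * (Y (n - m + 1) - Y (n - m - 1)))"
proof -
  define A where "A k = (if k \<le> n - 2 then real (k + 1) powr - \<alpha> * Y (n - k) else 0)" for k
  define D where "D k = (if k \<ge> 2 then real (k - 1) powr - \<alpha> * Y (n - k) else 0)" for k
  have "omega \<alpha> n k * Y (n - k) = A k - D k" if "k \<le> n" for k
  proof -
    consider "k = 0" | "k = 1" | "2 \<le> k" "k \<le> n - 2" | "k = n - 1" | "k = n"
      using \<open>k \<le> n\<close> by linarith
    then show ?thesis
    proof cases
      case 3
      then have "real (k - 1) = real k - 1" by (simp add: of_nat_diff)
      then show ?thesis using 3 n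
        by (simp add: omega_def A_def D_def powr_minus_divide left_diff_distrib add.commute)
    next
      case 4
      then have k: "k \<noteq> 0" "k \<noteq> 1" "\<not> k \<le> n - 2" "2 \<le> k" "real n - 2 = real k - 1"
        using n by (auto simp: of_nat_diff)
      then have "omega \<alpha> n k = - (1 / (real n - 2) powr \<alpha>)"
        unfolding omega_def using 4 by presburger
      then show ?thesis
        unfolding A_def D_def using k by (simp add: powr_minus_divide)
    next
      case 5
      then have "real (k - 1) = real n - 1" "n \<noteq> n - Suc 0" "\<not> n \<le> n - 2"
        using n by (auto simp: of_nat_diff)
      then show ?thesis using 5 n by (simp add: omega_def A_def D_def powr_minus_divide)
    qed (use n in \<open>simp_all add: omega_def A_def D_def powr_minus_divide\<close>)
  qed
  then have "(\<Sum>k=0..n. omega \<alpha> n k * Y (n - k)) = (\<Sum>k=0..n. A k) - (\<Sum>k=0..n. D k)"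
    by (simp add: sum_subtractf)
  also have "(\<Sum>k=0..n. A k) = (\<Sum>k\<in>{0..n-2}. A k)"
    by (rule sum.mono_neutral_right) (auto simp: A_def)
  also have "\<dots> = (\<Sum>m=1..<n. real m powr - \<alpha> * Y (n - m + 1))"
    by (rule sum.reindex_bij_witness[of _ "\<lambda>m. m - 1" "\<lambda>k. k + 1"])
       (use n in \<open>auto simp: A_def Suc_diff_Suc\<close>)
  also have "(\<Sum>k=0..n. D k) = (\<Sum>k\<in>{2..n}. D k)"
    by (rule sum.mono_neutral_right) (auto simp: D_def)
  also have "\<dots> = (\<Sum>m=1..<n. real m powr - \<alpha> * Y (n - m - 1))"
    by (rule sum.reindex_bij_witness[of _ "\<lambda>m. m + 1" "\<lambda>k. k - 1"])
       (use n in \<open>auto simp: D_def\<close>)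
  finally show ?thesis by (simp add: right_diff_distrib sum_subtractf)
qed

lemma integral_reflect_interval:
  fixes f :: "real \<Rightarrow> real"
  shows "integral {0..x} (\<lambda>t. f (x - t)) = integral {0..x} f"
proof -
  have "integral {0 - x..x - x} (\<lambda>t. f (x - (t + x))) = integral {0..x} (\<lambda>t. f (x - t))"
    using integral_shift_real_ivl[of 0 x x "\<lambda>t. f (x - t)"] by simp
  moreover have "integral {- x..- 0} (\<lambda>t. f (- t)) = integral {0..x} f"
    by (rule Henstock_Kurzweil_Integration.integral_reflect_real)
  ultimately show ?thesis by simp
qed

theorem lemma2:
  fixes \<alpha> x :: real and y :: "real \<Rightarrow> real"
  assumes "0 < \<alpha>" and "\<alpha> < 1" and "0 < x"
    and "smooth_within {0..x} y"
    and "y 0 = 0" and "nth_deriv_within 1 {0..x} y 0 = 0"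
  shows "\<exists>C. \<forall>n\<ge>4. let h = x / real n in
     \<bar>1 / (2 * Gamma (1 - \<alpha>) * h powr \<alpha>) * (\<Sum>k=0..n. omega \<alpha> n k * y (real (n - k) * h))
       - (caputo_deriv \<alpha> y x
          + Re (zeta (of_real \<alpha>)) / Gamma (1 - \<alpha>)
              * nth_deriv_within 1 {0..x} y x * h powr (1 - \<alpha>)
          - Re (zeta (of_real (\<alpha> - 1))) / Gamma (1 - \<alpha>)
              * nth_deriv_within 2 {0..x} y x * h powr (2 - \<alpha>))\<bar>
     \<le> C * h ^ 2"
proof -
  define D where "D k = nth_deriv_within k {0..x} y" for k
  define G where "G = Gamma (1 - \<alpha>)"
  have G: "G > 0" unfolding G_def using assms by (intro Gamma_real_pos) auto
  have deriv: "(D k has_real_derivative D (Suc k) t) (at t within {0..x})" if "t \<in> {0..x}" for k t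
    using assms(4) that
    by (auto simp: smooth_within_def differentiable_on_def D_def has_real_derivative_iff_has_vector_derivative
             vector_derivative_works)
  have "continuous_on {0..x} (D 3)"
    by (rule DERIV_continuous_on) (rule deriv)
  then have "bounded (D 3 ` {0..x})"
    by (intro compact_imp_bounded compact_continuous_image) auto
  then obtain B where B: "\<And>t. t \<in> {0..x} \<Longrightarrow> \<bar>D 3 t\<bar> \<le> B"
    unfolding bounded_iff by (metis image_eqI real_norm_def)
  have reflect: "((\<lambda>u. D k (x - u)) has_real_derivative - D (Suc k) (x - u)) (at u within {0..x})"
    if "u \<in> {0..x}" for k u
  proof -
    have "(\<lambda>u. x - u) ` {0..x} = {0..x}"
      by (auto simp: image_iff intro!: bexI[of _ "x - _"])
    then have "(D k has_real_derivative D (Suc k) (x - u)) (at (x - u) within (\<lambda>u. x - u) ` {0..x})"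
      using deriv[of "x - u" k] that by auto
    moreover have "((\<lambda>u. x - u) has_real_derivative - 1) (at u within {0..x})"
      by (auto intro!: derivative_eq_intros)
    ultimately have "(D k \<circ> (\<lambda>u. x - u) has_real_derivative D (Suc k) (x - u) * - 1) (at u within {0..x})"
      by (rule DERIV_image_chain)
    then show ?thesis by (simp only: o_def mult_minus1_right)
  qed
  interpret singular_integrand \<alpha> x B "\<lambda>u. D 1 (x - u)" "\<lambda>u. - D 2 (x - u)" "\<lambda>u. D 3 (x - u)"
  proof
    show "((\<lambda>u. D 1 (x - u)) has_real_derivative - D 2 (x - t)) (at t within {0..x})" if "t \<in> {0..x}" for t
      using reflect[OF that, of 1] by (simp add: eval_nat_numeral)
    show "((\<lambda>u. - D 2 (x - u)) has_real_derivative D 3 (x - t)) (at t within {0..x})" if "t \<in> {0..x}" for t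
      using DERIV_minus[OF reflect[OF that, of 2]] by (simp add: eval_nat_numeral)
    show "\<bar>D 3 (x - t)\<bar> \<le> B" if "t \<in> {0..x}" for t
      using B[of "x - t"] that by auto
  qed (use assms in auto)
  define f where "f u = u powr - \<alpha> * D 1 (x - u)" for u
  have caputo: "caputo_deriv \<alpha> y x = integral {0..x} f / G"
  proof -
    have "f (x - t) = D 1 t / (x - t) powr \<alpha>" for t
      by (simp add: f_def powr_minus_divide)
    then show ?thesis
      using integral_reflect_interval[of x f] unfolding caputo_deriv_def D_def[symmetric] G_def[symmetric] by simp
  qed
  define z where "z s = Re (zeta (of_real s))" for s :: real
  obtain C where C: "\<And>n. n \<ge> 1 \<Longrightarrow> \<bar>punctured_trapezoid f x n
       - (integral {0..x} f + z \<alpha> * D 1 x * (x / real n) powr (1 - \<alpha>)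
          - z (\<alpha> - 1) * D 2 x * (x / real n) powr (2 - \<alpha>))\<bar> \<le> C * (x / real n) ^ 2"
    using singular_euler_maclaurin unfolding Let_def f_def[symmetric] z_def[symmetric] by auto
  define C' where "C' = B * (x powr (1 - \<alpha>) / (1 - \<alpha>))"
  \<comment> \<open>Replacing a central difference by a derivative costs \<open>O(h^3)\<close>, and the weights
    \<open>(m h) powr - \<alpha>\<close> of these errors add up to \<open>O(1 / h)\<close>.\<close>
  have differences: "\<bar>(\<Sum>k=0..n. omega \<alpha> n k * y (real (n - k) * h)) / (2 * h powr \<alpha>) - punctured_trapezoid f x n\<bar>
      \<le> C' * h ^ 2" if n: "n \<ge> 4" and h_eq: "h = x / real n" for n h
  proof -
    have h: "h > 0" "real n * h = x" using assms n by (auto simp: h_eq)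
    define d where "d m = y (x - real m * h + h) - y (x - real m * h - h)" for m
    have sum_eq: "(\<Sum>k=0..n. omega \<alpha> n k * y (real (n - k) * h)) = (\<Sum>m=1..<n. real m powr - \<alpha> * d m)"
    proof -
      have "real (n - m + 1) * h = x - real m * h + h" "real (n - m - 1) * h = x - real m * h - h"
        if "m \<in> {1..<n}" for m
        using that h(2) by (auto simp: of_nat_diff algebra_simps)
      then show ?thesis
        unfolding sum_omega_eq[OF n, of \<alpha> "\<lambda>j. y (real j * h)"] d_def by (intro sum.cong) auto
    qed
    \<comment> \<open>The initial condition on \<open>y'\<close> makes the endpoint term of the trapezoidal sum vanish.\<close>
    have "f x = 0"
      using assms(6) by (simp add: f_def D_def)
    then have trap_eq: "punctured_trapezoid f x n = h * (\<Sum>m=1..<n. f (real m * h))"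
      by (simp add: punctured_trapezoid_def h_eq)
    have "(\<Sum>k=0..n. omega \<alpha> n k * y (real (n - k) * h)) / (2 * h powr \<alpha>) - punctured_trapezoid f x n
        = (\<Sum>m=1..<n. (real m * h) powr - \<alpha> / 2 * (d m - 2 * h * D 1 (x - real m * h)))"
      unfolding sum_eq trap_eq sum_divide_distrib sum_distrib_left sum_subtractf[symmetric]
    proof (rule sum.cong)
      fix m
      have "(real m * h) powr - \<alpha> = real m powr - \<alpha> / h powr \<alpha>"
        using h by (simp add: powr_mult powr_minus_divide)
      then show "real m powr - \<alpha> * d m / (2 * h powr \<alpha>) - h * f (real m * h)
          = (real m * h) powr - \<alpha> / 2 * (d m - 2 * h * D 1 (x - real m * h))"
        by (simp add: f_def algebra_simps)
    qed simp
    also have "\<bar>\<dots>\<bar> \<le> (\<Sum>m=1..<n. (real m * h) powr - \<alpha> / 2 * (2 * B * h ^ 3))"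
    proof (rule order_trans[OF sum_abs sum_mono])
      fix m assume m: "m \<in> {1..<n}"
      have mh: "h \<le> real m * h" "real m * h + h \<le> x"
      proof -
        show "h \<le> real m * h" using m h by simp
        have "(real m + 1) * h \<le> real n * h"
          using m h by (intro mult_right_mono) auto
        then show "real m * h + h \<le> x" using h by (simp add: algebra_simps)
      qed
      have "D 0 = y" by (simp add: D_def)
      then have "\<bar>d m - 2 * h * D 1 (x - real m * h)\<bar> \<le> 2 * B * h ^ 3"
        using central_difference_error[of 0 x D B "x - real m * h" h] deriv B mh h by (auto simp: d_def)
      then show "\<bar>(real m * h) powr - \<alpha> / 2 * (d m - 2 * h * D 1 (x - real m * h))\<bar>
          \<le> (real m * h) powr - \<alpha> / 2 * (2 * B * h ^ 3)"
        unfolding abs_mult by (intro mult_mono) auto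
    qed
    also have "\<dots> = B * h ^ 2 * (h * (\<Sum>m=1..<n. (real m * h) powr - \<alpha>))"
      by (simp add: sum_distrib_left eval_nat_numeral mult_ac)
    also have "\<dots> \<le> B * h ^ 2 * (x powr (1 - \<alpha>) / (1 - \<alpha>))"
      using riemann_sum_powr_le[OF \<alpha> h(1), of n] B_nonneg by (intro mult_left_mono) (auto simp: h(2))
    finally show ?thesis by (simp add: C'_def mult_ac)
  qed
  have "\<bar>1 / (2 * G * h powr \<alpha>) * (\<Sum>k=0..n. omega \<alpha> n k * y (real (n - k) * h))
       - (caputo_deriv \<alpha> y x + z \<alpha> / G * D 1 x * h powr (1 - \<alpha>)
          - z (\<alpha> - 1) / G * D 2 x * h powr (2 - \<alpha>))\<bar>
     \<le> ((C' + C) / G) * h ^ 2" if n: "n \<ge> 4" and h: "h = x / real n" for n h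
  proof -
    define S where "S = (\<Sum>k=0..n. omega \<alpha> n k * y (real (n - k) * h)) / (2 * h powr \<alpha>)"
    define R where "R = integral {0..x} f + z \<alpha> * D 1 x * h powr (1 - \<alpha>) - z (\<alpha> - 1) * D 2 x * h powr (2 - \<alpha>)"
    have "\<bar>S - R\<bar> \<le> C' * h ^ 2 + C * h ^ 2"
      using differences[OF n h] C[of n] n unfolding S_def R_def h[symmetric] by linarith
    then have "\<bar>S - R\<bar> / G \<le> (C' * h ^ 2 + C * h ^ 2) / G"
      using G by (simp add: divide_right_mono)
    moreover have "1 / (2 * G * h powr \<alpha>) * (\<Sum>k=0..n. omega \<alpha> n k * y (real (n - k) * h))
       - (caputo_deriv \<alpha> y x + z \<alpha> / G * D 1 x * h powr (1 - \<alpha>)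
          - z (\<alpha> - 1) / G * D 2 x * h powr (2 - \<alpha>)) = (S - R) / G"
      by (simp add: S_def R_def caputo diff_divide_distrib add_divide_distrib mult_ac)
    ultimately show ?thesis
      using G by (simp add: abs_divide add_divide_distrib distrib_right)
  qed
  then show ?thesis
    unfolding D_def G_def z_def Let_def by blast
qed

end
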